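(* Let $n\ge 4$. The number of blockers (for triangulations of a convex $n$-gon $C$), counted up to cyclic rotations of the vertices of $C$, is $F_{2n-8}$.
   Context: $P$ is a set of $n$ points in convex position in the plane forming a convex $n$-gon $C$, labelled cyclically clockwise $0,1,\ldots,n-1$ (indices modulo $n$). $G$ is the complete geometric graph on $P$. The order of an edge $(i,j)$ is $\min\{|i-j|,n-|i-j|\}$; a diagonal of $C$ is an edge of order at least $2$. Two distinct edges cross if they share an interior point. A triangulation of $C$ is a maximal (with respect to inclusion) set of pairwise non-crossing diagonals of $C$. A blocking set is a set of edges of $G$ that has at least one edge in common with every triangulation of $C$. A blocker is a blocking set with the minimum possible number of edges. Two blockers are identified up to rotation if one is obtained from the other by a shift $v\mapsto v+r \pmod n$ of the vertices. The Fibonacci sequence is defined by $F_1=F_2=1$, $F_k=F_{k-1}+F_{k-2}$ for $k\ge 3$, and, by convention here, $F_0=1$ (this differs from the natural extension of the Fibonacci sequence). *)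

theory Defs
  imports "HOL-Analysis.Analysis" "HOL-Number_Theory.Fib"
begin

definition convex_position :: "'a::real_vector set \<Rightarrow> bool" where
  "convex_position S \<longleftrightarrow> (\<forall>x\<in>S. x \<notin> convex hull (S - {x}))"

(* Signed double area of the triangle abc: negative iff c lies strictly to the
   right of the line directed from a to b. *)
definition orient :: "real^2 \<Rightarrow> real^2 \<Rightarrow> real^2 \<Rightarrow> real" where
  "orient a b c = (b$1 - a$1) * (c$2 - a$2) - (b$2 - a$2) * (c$1 - a$1)"

(* The last conjunct says that the labelling runs clockwise around the boundary:
   each directed segment from P i to P (i + 1) is a side of the convex polygon,
   with all the other vertices strictly to its right. *)
definition clockwise_ngon :: "nat \<Rightarrow> (nat \<Rightarrow> real^2) \<Rightarrow> bool" where
  "clockwise_ngon n P \<longleftrightarrow>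
     inj_on P {..<n} \<and>
     convex_position (P ` {..<n}) \<and>
     (\<forall>i<n. \<forall>k<n. k \<noteq> i \<and> k \<noteq> (i + 1) mod n \<longrightarrow>
        orient (P i) (P ((i + 1) mod n)) (P k) < 0)"

(* A vertex is represented by its label; an edge is the set of its two end labels. *)
definition edges :: "nat \<Rightarrow> nat set set" where
  "edges n = {{i, j} | i j. i < n \<and> j < n \<and> i \<noteq> j}"

definition edge_order :: "nat \<Rightarrow> nat \<Rightarrow> nat \<Rightarrow> int" where
  "edge_order n i j = min \<bar>int i - int j\<bar> (int n - \<bar>int i - int j\<bar>)"

definition diagonals :: "nat \<Rightarrow> nat set set" where
  "diagonals n = {{i, j} | i j. i < n \<and> j < n \<and> i \<noteq> j \<and> edge_order n i j \<ge> 2}"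

definition crossing :: "(nat \<Rightarrow> real^2) \<Rightarrow> nat set \<Rightarrow> nat set \<Rightarrow> bool" where
  "crossing P e f \<longleftrightarrow> e \<noteq> f \<and>
     (\<exists>i j k l. e = {i, j} \<and> f = {k, l} \<and>
        open_segment (P i) (P j) \<inter> open_segment (P k) (P l) \<noteq> {})"

definition noncrossing_diagonals :: "nat \<Rightarrow> (nat \<Rightarrow> real^2) \<Rightarrow> nat set set \<Rightarrow> bool" where
  "noncrossing_diagonals n P T \<longleftrightarrow>
     T \<subseteq> diagonals n \<and> pairwise (\<lambda>e f. \<not> crossing P e f) T"

definition triangulation :: "nat \<Rightarrow> (nat \<Rightarrow> real^2) \<Rightarrow> nat set set \<Rightarrow> bool" where
  "triangulation n P T \<longleftrightarrow> noncrossing_diagonals n P T \<and>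
     (\<forall>T'. noncrossing_diagonals n P T' \<and> T \<subseteq> T' \<longrightarrow> T' = T)"

definition blocking_set :: "nat \<Rightarrow> (nat \<Rightarrow> real^2) \<Rightarrow> nat set set \<Rightarrow> bool" where
  "blocking_set n P B \<longleftrightarrow>
     B \<subseteq> edges n \<and> (\<forall>T. triangulation n P T \<longrightarrow> B \<inter> T \<noteq> {})"

definition blocker :: "nat \<Rightarrow> (nat \<Rightarrow> real^2) \<Rightarrow> nat set set \<Rightarrow> bool" where
  "blocker n P B \<longleftrightarrow> blocking_set n P B \<and>
     (\<forall>B'. blocking_set n P B' \<longrightarrow> card B \<le> card B')"

definition blockers :: "nat \<Rightarrow> (nat \<Rightarrow> real^2) \<Rightarrow> nat set set set" where
  "blockers n P = {B. blocker n P B}"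

definition shift :: "nat \<Rightarrow> nat \<Rightarrow> nat set set \<Rightarrow> nat set set" where
  "shift n r B = (\<lambda>e. (\<lambda>v. (v + r) mod n) ` e) ` B"

definition rotation_rel :: "nat \<Rightarrow> (nat \<Rightarrow> real^2) \<Rightarrow> (nat set set \<times> nat set set) set" where
  "rotation_rel n P =
     {(A, B). A \<in> blockers n P \<and> B \<in> blockers n P \<and> (\<exists>r. B = shift n r A)}"

(* The library function has fib 0 = 0; the convention here is F 0 = 1. *)
definition F :: "nat \<Rightarrow> nat" where
  "F k = (if k = 0 then 1 else fib k)"

end

(* Interleaving of labels decides crossing, so the problem is purely combinatorial.  Call v an ear of
   a set B of edges if the diagonal {v - 1, v + 1} belongs to B.  If v is not an ear of a blocking set
   B of the n-gon, then deleting v and the edges of B at v leaves a blocking set of the (n-1)-gon, and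
   the fan at v forces B to have an edge at v.  Hence a blocker has n - 2 edges, exactly one at each
   vertex that is not an ear, and none between two such vertices.

   For n >= 5 the ears of a blocker form, after a unique rotation, an interval 0, ..., k - 1; the other
   vertices k, k + 1, ..., n - 1 are joined to ears W!0, W!1, ..., and the remaining edges are the
   diagonals {i, i + 2} between ears.  Deleting the vertex that follows the last ear shows that each
   blocker of the (n+1)-gon arises from one of the n-gon by one of three insertions, the third being
   available only when no W!i equals k - 1.  If N and G count all pairs (k, W) and those of the latter
   kind, then N' = 2 N + G and G' = N + G, which is the recursion of consecutive Fibonacci numbers. *)

theory Submission
  imports Defs
begin

subsection \<open>Crossing diagonals of a convex polygon\<close>

text \<open>Adding the diagonal {v - 1, v + 1} to any triangulation of the polygon without v gives
  one of the whole polygon. A blocking set for which v is not an ear misses this diagonal, so it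
  must already meet the smaller triangulation. A non-ear exists once n >= 5 and there are fewer than
  n edges, since the n diagonals {v - 1, v + 1} are then distinct. In the quadrilateral they
  coincide in pairs and every vertex is an ear; so n = 4 stays outside the normal form, and the
  enumeration starts at the pentagon.

  That the normal forms block is shown by an opposite deletion: a triangulation is cut at one of its
  own ears. This can create new ears in the edge set, so the induction runs over the weaker
  \<open>precode\<close> instead of \<open>code\<close>. The inequality
  \<open>W ! j \<le> Suc (W ! i)\<close> says that two edges at the vertices after the interval
  cross only if their ends inside the interval are consecutive; it keeps the last ear free of other
  edges when that ear has to be given up.\<close>

lemma orient_rotate: "orient b c a = orient a b c"
  by (simp add: orient_def algebra_simps)

lemma orient_swap: "orient a c b = - orient a b c"
  by (simp add: orient_def algebra_simps)

text \<open>The three-term Grassmann-Pluecker relation for directions seen from \<open>p\<close>. It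
  carries signs of triangles on the reference side \<open>p u\<close> over to a triangle without
  that side.\<close>

lemma orient_pluecker:
  "orient p u b * orient p a c = orient p u a * orient p b c + orient p u c * orient p a b"
  by (simp add: orient_def algebra_simps)

lemma orient_convex_combination:
  "orient a b ((1 - s) *\<^sub>R c + s *\<^sub>R d) = (1 - s) * orient a b c + s * orient a b d"
  by (simp add: orient_def algebra_simps)

lemma orient_degenerate [simp]: "orient a b a = 0" "orient a b b = 0"
  by (simp_all add: orient_def)

lemma clockwise_side:
  assumes "clockwise_ngon n P" "Suc i < n" "k < n" "k \<noteq> i" "k \<noteq> Suc i"
  shows "orient (P i) (P (Suc i)) (P k) < 0"
  using assms unfolding clockwise_ngon_def by (auto dest: spec[of _ i])

text \<open>\<open>clockwise_ngon\<close> fixes the sign only of triangles that contain a side of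
  the polygon. The far vertex is moved by one step at a time; when \<open>j\<close> is not next to
  \<open>i\<close>, the Pluecker relation with reference side from \<open>P i\<close> to
  \<open>P (Suc i)\<close> expresses the unknown sign through negative ones.\<close>

lemma clockwise_orient:
  assumes P: "clockwise_ngon n P" and "i < j" "j < k" "k < n"
  shows "orient (P i) (P j) (P k) < 0"
  using \<open>j < k\<close> \<open>k < n\<close>
proof (induction k)
  case 0
  then show ?case by simp
next
  case (Suc k)
  have step: "orient (P i) (P k) (P (Suc k)) < 0" if "i < k"
    using clockwise_side[OF P, of k i] Suc.prems that orient_rotate[of "P k" "P (Suc k)" "P i"] by simp
  show ?case
  proof (cases "j = k")
    case True
    then show ?thesis using step \<open>i < j\<close> by simp
  next
    case False
    then have "j < k" using Suc.prems by simp
    show ?thesis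
    proof (cases "j = Suc i")
      case True
      then show ?thesis using clockwise_side[OF P, of i "Suc k"] Suc.prems by simp
    next
      case False
      have neg: "orient (P i) (P (Suc i)) (P x) < 0" if "x \<in> {j, k, Suc k}" for x
        using clockwise_side[OF P, of i x] that Suc.prems False \<open>i < j\<close> \<open>j < k\<close> by auto
      have "orient (P i) (P j) (P k) < 0"
        using Suc \<open>j < k\<close> by simp
      then have "orient (P i) (P (Suc i)) (P k) * orient (P i) (P j) (P (Suc k)) > 0"
        using orient_pluecker[of "P i" "P (Suc i)" "P k" "P j" "P (Suc k)"] neg step \<open>i < j\<close> \<open>j < k\<close>
        by (simp add: add_pos_pos mult_neg_neg)
      then show ?thesis using neg[of k] by (simp add: zero_less_mult_iff)
    qed
  qed
qed

section \<open>Crossing as interleaving of labels\<close>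

definition interleaved :: "nat set \<Rightarrow> nat set \<Rightarrow> bool" where
  "interleaved e f \<longleftrightarrow> (\<exists>a b c d. a < b \<and> b < c \<and> c < d \<and>
     (e = {a, c} \<and> f = {b, d} \<or> e = {b, d} \<and> f = {a, c}))"

lemma interleaved_sym: "interleaved e f \<Longrightarrow> interleaved f e"
  unfolding interleaved_def by blast

text \<open>\<open>s\<close> and \<open>t\<close> are the ratios of signed areas at which each
  segment is cut by the line through the other. Multiplied by the common denominator
  \<open>D\<close>, equality of the two points becomes a polynomial identity in the
  coordinates.\<close>

lemma segments_meet:
  assumes "orient a b c > 0" "orient a b d < 0" "orient c d a < 0" "orient c d b > 0"
  shows "open_segment a b \<inter> open_segment c d \<noteq> {}"
proof -
  define s where "s = orient a b c / (orient a b c - orient a b d)"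
  define t where "t = orient c d a / (orient c d a - orient c d b)"
  have s: "0 < s" "s < 1" using assms by (auto simp: s_def field_simps)
  have t: "0 < t" "t < 1" using assms by (auto simp: t_def field_simps)
  have ab: "a \<noteq> b" using assms(1,2) by (auto simp: orient_def)
  have cd: "c \<noteq> d" using assms by auto
  define D where "D = orient a b c - orient a b d"
  have D: "D \<noteq> 0" using assms by (simp add: D_def)
  have D': "orient c d a - orient c d b = - D"
    by (simp add: D_def orient_def algebra_simps)
  have "D *\<^sub>R ((1 - t) *\<^sub>R a + t *\<^sub>R b) = D *\<^sub>R ((1 - s) *\<^sub>R c + s *\<^sub>R d)"
  proof -
    have st: "D * s = orient a b c" "D * t = - orient c d a"
      using D D' by (simp_all add: s_def t_def D_def[symmetric])
    have "D *\<^sub>R ((1 - t) *\<^sub>R a + t *\<^sub>R b) = D *\<^sub>R a + (D * t) *\<^sub>R (b - a)"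
      by (simp add: algebra_simps)
    also have "\<dots> = D *\<^sub>R c + (D * s) *\<^sub>R (d - c)"
      unfolding st by (simp add: vec_eq_iff forall_2 D_def orient_def algebra_simps)
    also have "\<dots> = D *\<^sub>R ((1 - s) *\<^sub>R c + s *\<^sub>R d)"
      by (simp add: algebra_simps)
    finally show ?thesis .
  qed
  then have eq: "(1 - t) *\<^sub>R a + t *\<^sub>R b = (1 - s) *\<^sub>R c + s *\<^sub>R d" using D by simp
  have "(1 - t) *\<^sub>R a + t *\<^sub>R b \<in> open_segment a b"
    using t ab by (auto simp: in_segment)
  moreover have "(1 - s) *\<^sub>R c + s *\<^sub>R d \<in> open_segment c d"
    using s cd by (auto simp: in_segment)
  ultimately show ?thesis using eq by auto
qed

text \<open>At a common point \<open>orient a b\<close> vanishes, yet it would also be a strict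
  convex combination of two values of the same weak sign that are not both zero. Weak signs cover
  segments with a shared endpoint.\<close>

lemma segments_disjoint:
  assumes "orient a b c \<ge> 0 \<and> orient a b d \<ge> 0 \<or> orient a b c \<le> 0 \<and> orient a b d \<le> 0"
    and "orient a b c \<noteq> 0 \<or> orient a b d \<noteq> 0"
  shows "open_segment a b \<inter> open_segment c d = {}"
proof (rule ccontr)
  assume "\<not> ?thesis"
  then obtain s t where s: "0 < s" "s < 1" and t: "0 < t" "t < 1"
    and eq: "(1 - t) *\<^sub>R a + t *\<^sub>R b = (1 - s) *\<^sub>R c + s *\<^sub>R d"
    by (force simp: in_segment)
  have "(1 - s) * orient a b c + s * orient a b d = 0"
    using orient_convex_combination[of a b s c d] orient_convex_combination[of a b t a b] eq by simp
  moreover have "(1 - s) * x + s * y > 0" if "x \<ge> 0" "y \<ge> 0" "x \<noteq> 0 \<or> y \<noteq> 0" for x y :: real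
    using that s by (metis add_nonneg_pos add_pos_nonneg diff_gt_0_iff_gt less_eq_real_def mult_nonneg_nonneg mult_pos_pos)
  from this[of "orient a b c" "orient a b d"] this[of "- orient a b c" "- orient a b d"]
  have "(1 - s) * orient a b c + s * orient a b d > 0 \<or> (1 - s) * orient a b c + s * orient a b d < 0"
    using assms by auto
  ultimately show False by simp
qed

lemma open_segments_meet_iff:
  assumes P: "clockwise_ngon n P" and "i < j" "j < n" "k < l" "l < n" "{i, j} \<noteq> {k, l}"
  shows "open_segment (P i) (P j) \<inter> open_segment (P k) (P l) \<noteq> {} \<longleftrightarrow>
    i < k \<and> k < j \<and> j < l \<or> k < i \<and> i < l \<and> l < j" (is "?meet \<longleftrightarrow> ?inter")
proof
  note neg = clockwise_orient[OF P]
  have crossing_meet: "open_segment (P i) (P j) \<inter> open_segment (P k) (P l) \<noteq> {}"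
    if "i < k" "k < j" "j < l" "l < n" for i j k l
    by (rule segments_meet)
      (use that neg[of i k j] neg[of i j l] neg[of i k l] neg[of k j l]
        orient_swap[of "P i" "P j" "P k"] orient_rotate[of "P k" "P l" "P i"]
        orient_swap[of "P k" "P l" "P j"] in auto)
  show ?meet if ?inter
    using that crossing_meet[of i k j l] crossing_meet[of k i l j] assms by (auto simp: Int_commute)
  show ?inter if ?meet
  proof (rule ccontr)
    assume no: "\<not> ?inter"
    have sign: "orient (P i) (P j) (P m) < 0" if "m < i \<or> j < m" "m < n" for m
      using that neg[of m i j] neg[of i j m] assms orient_rotate[of "P i" "P j" "P m"] by auto
    have sign': "orient (P i) (P j) (P m) > 0" if "i < m" "m < j" for m
      using that neg[of i m j] assms orient_swap[of "P i" "P j" "P m"] by auto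
    have out: "orient (P i) (P j) (P m) \<le> 0" if "m \<le> i \<or> j \<le> m" "m < n" for m
      using that sign[of m] by (cases "m = i \<or> m = j") (auto intro: less_imp_le)
    have inn: "orient (P i) (P j) (P m) \<ge> 0" if "i \<le> m" "m \<le> j" for m
      using that sign'[of m] by (cases "m = i \<or> m = j") (auto intro: less_imp_le)
    have nz: "orient (P i) (P j) (P m) \<noteq> 0" if "m \<noteq> i" "m \<noteq> j" "m < n" for m
      using that sign[of m] sign'[of m] by (metis linorder_neqE_nat order_less_irrefl)
    have "open_segment (P i) (P j) \<inter> open_segment (P k) (P l) = {}"
    proof (rule segments_disjoint)
      \<comment> \<open>Without interleaving, \<open>k\<close> and \<open>l\<close> lie in the same
        closed arc cut off by \<open>i\<close> and \<open>j\<close>; as the edges differ, at least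
        one of them lies off the line.\<close>
      have "(i \<le> k \<and> k \<le> j) \<and> (i \<le> l \<and> l \<le> j) \<or> (k \<le> i \<or> j \<le> k) \<and> (l \<le> i \<or> j \<le> l)"
        using no assms by auto
      then show "orient (P i) (P j) (P k) \<ge> 0 \<and> orient (P i) (P j) (P l) \<ge> 0 \<or>
          orient (P i) (P j) (P k) \<le> 0 \<and> orient (P i) (P j) (P l) \<le> 0"
        using inn out assms by (meson less_trans)
      have "k \<notin> {i, j} \<or> l \<notin> {i, j}" using assms by auto
      then show "orient (P i) (P j) (P k) \<noteq> 0 \<or> orient (P i) (P j) (P l) \<noteq> 0"
        using nz assms by (auto dest: less_trans)
    qed
    then show False using that by simp
  qed
qed

lemma edgesE:
  assumes "e \<in> edges n"
  obtains i j where "e = {i, j}" "i < j" "j < n"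
proof -
  from assms obtain i j where "e = {i, j}" "i < n" "j < n" "i \<noteq> j"
    unfolding edges_def by blast
  then show thesis using that[of i j] that[of j i] by (cases "i < j") (auto simp: insert_commute)
qed

lemma interleaved_doubletons:
  assumes "i < j" "k < (l::nat)"
  shows "interleaved {i, j} {k, l} \<longleftrightarrow> i < k \<and> k < j \<and> j < l \<or> k < i \<and> i < l \<and> l < j"
proof
  assume "interleaved {i, j} {k, l}"
  then show "i < k \<and> k < j \<and> j < l \<or> k < i \<and> i < l \<and> l < j"
    using assms unfolding interleaved_def doubleton_eq_iff by (elim exE conjE disjE) auto
qed (use assms in \<open>unfold interleaved_def, blast\<close>)

lemma crossing_iff_interleaved:
  assumes P: "clockwise_ngon n P" and "e \<in> edges n" "f \<in> edges n"
  shows "crossing P e f \<longleftrightarrow> interleaved e f"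
proof -
  obtain i j where e: "e = {i, j}" "i < j" "j < n" using assms(2) by (rule edgesE)
  obtain k l where f: "f = {k, l}" "k < l" "l < n" using assms(3) by (rule edgesE)
  have "crossing P e f \<longleftrightarrow> e \<noteq> f \<and> open_segment (P i) (P j) \<inter> open_segment (P k) (P l) \<noteq> {}"
    unfolding crossing_def e(1) f(1) doubleton_eq_iff
    by (smt (verit, ccfv_threshold) open_segment_commute)
  also have "\<dots> \<longleftrightarrow> interleaved e f"
    using open_segments_meet_iff[OF P e(2,3) f(2,3)] interleaved_doubletons[OF e(2) f(2)] e f
    by (auto simp: doubleton_eq_iff)
  finally show ?thesis .
qed

subsection \<open>Triangulations of a labelled polygon\<close>

lemma edges_iff: "e \<in> edges n \<longleftrightarrow> (\<exists>i j. e = {i, j} \<and> i < j \<and> j < n)"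
proof
  show "\<exists>i j. e = {i, j} \<and> i < j \<and> j < n" if "e \<in> edges n"
    using that by (rule edgesE) blast
qed (force simp: edges_def)

lemma doubleton_in_edges [simp]: "{i, j} \<in> edges n \<longleftrightarrow> i \<noteq> j \<and> i < n \<and> j < n"
  unfolding edges_def by (auto simp: doubleton_eq_iff)

lemma edges_subset: "e \<in> edges n \<Longrightarrow> e \<subseteq> {..<n}"
  by (auto simp: edges_def)

lemma finite_edges [simp]: "finite (edges n)"
  by (rule finite_subset[of _ "Pow {..<n}"]) (use edges_subset in auto)

lemma edges_mono: "m \<le> n \<Longrightarrow> edges m \<subseteq> edges n"
  by (force simp: edges_def)

lemma doubleton_in_diagonals:
  assumes "i < j"
  shows "{i, j} \<in> diagonals n \<longleftrightarrow> Suc i < j \<and> j < n \<and> (i = 0 \<longrightarrow> Suc j < n)"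
proof -
  have sym: "edge_order n j i = edge_order n i j"
    by (simp add: edge_order_def abs_minus_commute)
  have "{i, j} \<in> diagonals n \<longleftrightarrow> j < n \<and> edge_order n i j \<ge> 2"
  proof (intro iffI conjI)
    assume "{i, j} \<in> diagonals n"
    then show "j < n" "edge_order n i j \<ge> 2"
      using assms sym unfolding diagonals_def by (auto simp: doubleton_eq_iff)
  next
    assume "j < n \<and> edge_order n i j \<ge> 2"
    then show "{i, j} \<in> diagonals n"
      using assms unfolding diagonals_def by (intro CollectI exI[of _ i] exI[of _ j]) auto
  qed
  then show ?thesis using assms by (auto simp: edge_order_def)
qed

lemma diagonals_subset_edges: "diagonals n \<subseteq> edges n"
  by (auto simp: diagonals_def edges_def)

lemma not_interleaved_self [simp]: "\<not> interleaved e e"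
  unfolding interleaved_def by (auto simp: doubleton_eq_iff)

text \<open>Being a diagonal thus depends on interleaving alone, so it passes through rotations and
  relabellings without any computation of edge orders.\<close>

lemma diagonal_iff_interleaved:
  "e \<in> diagonals n \<longleftrightarrow> e \<in> edges n \<and> (\<exists>f\<in>edges n. interleaved e f)"
proof
  assume e: "e \<in> diagonals n"
  with diagonals_subset_edges obtain i j where ij: "e = {i, j}" "i < j" "j < n"
    by (meson edgesE subsetD)
  with e have d: "Suc i < j" "i = 0 \<longrightarrow> Suc j < n" by (auto simp: doubleton_in_diagonals)
  have "\<exists>f\<in>edges n. interleaved e f"
  proof (cases "i = 0")
    case True
    then have "interleaved e {Suc i, Suc j}" using ij d by (simp add: interleaved_doubletons)
    then show ?thesis using True ij d by (intro bexI) auto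
  next
    case False
    then have "interleaved e {0, Suc i}" using ij d by (simp add: interleaved_doubletons)
    then show ?thesis using ij d by (intro bexI) auto
  qed
  then show "e \<in> edges n \<and> (\<exists>f\<in>edges n. interleaved e f)"
    using e diagonals_subset_edges by auto
next
  assume "e \<in> edges n \<and> (\<exists>f\<in>edges n. interleaved e f)"
  then show "e \<in> diagonals n"
    by (auto simp: edges_iff interleaved_doubletons doubleton_in_diagonals)
qed

text \<open>Maximality is tested with single diagonals: crossing is a pairwise condition, so a
  non-crossing set that can be enlarged at all can be enlarged by one diagonal.\<close>

definition tri :: "nat \<Rightarrow> nat set set \<Rightarrow> bool" where
  "tri n T \<longleftrightarrow> T \<subseteq> diagonals n \<and> (\<forall>e\<in>T. \<forall>f\<in>T. \<not> interleaved e f) \<and>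
     (\<forall>e\<in>diagonals n. (\<forall>f\<in>T. \<not> interleaved e f) \<longrightarrow> e \<in> T)"

lemma triD:
  assumes "tri n T"
  shows "e \<in> T \<Longrightarrow> e \<in> diagonals n" "e \<in> T \<Longrightarrow> e \<in> edges n"
    "e \<in> T \<Longrightarrow> f \<in> T \<Longrightarrow> \<not> interleaved e f"
    "e \<in> diagonals n \<Longrightarrow> (\<And>f. f \<in> T \<Longrightarrow> \<not> interleaved e f) \<Longrightarrow> e \<in> T"
  using assms diagonals_subset_edges unfolding tri_def by blast+

lemma triI:
  assumes "\<And>e. e \<in> T \<Longrightarrow> e \<in> diagonals n"
    and "\<And>e f. e \<in> T \<Longrightarrow> f \<in> T \<Longrightarrow> \<not> interleaved e f"
    and "\<And>e. e \<in> diagonals n \<Longrightarrow> (\<And>f. f \<in> T \<Longrightarrow> \<not> interleaved e f) \<Longrightarrow> e \<in> T"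
  shows "tri n T"
  using assms unfolding tri_def by blast

lemma noncrossing_diagonals_iff:
  assumes "clockwise_ngon n P"
  shows "noncrossing_diagonals n P T \<longleftrightarrow>
    T \<subseteq> diagonals n \<and> (\<forall>e\<in>T. \<forall>f\<in>T. \<not> interleaved e f)"
proof -
  have "crossing P e f \<longleftrightarrow> interleaved e f" if "T \<subseteq> diagonals n" "e \<in> T" "f \<in> T" for e f
    using that crossing_iff_interleaved[OF assms, of e f] diagonals_subset_edges by blast
  then show ?thesis
    unfolding noncrossing_diagonals_def pairwise_def by (metis not_interleaved_self)
qed

lemma triangulation_iff_tri:
  assumes "clockwise_ngon n P"
  shows "triangulation n P T \<longleftrightarrow> tri n T"
proof
  assume T: "triangulation n P T"
  show "tri n T"
  proof (rule triI)
    fix e assume e: "e \<in> diagonals n" "\<And>f. f \<in> T \<Longrightarrow> \<not> interleaved e f"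
    have "noncrossing_diagonals n P (insert e T)"
      using T e unfolding triangulation_def noncrossing_diagonals_iff[OF assms]
      by (auto dest: interleaved_sym)
    then show "e \<in> T" using T unfolding triangulation_def by blast
  qed (use T in \<open>auto simp: triangulation_def noncrossing_diagonals_iff[OF assms]\<close>)
next
  assume "tri n T"
  then show "triangulation n P T"
    unfolding triangulation_def noncrossing_diagonals_iff[OF assms] tri_def by blast
qed

text \<open>A diagonal that avoids \<open>v\<close> is crossed by an edge from \<open>v\<close> to
  some vertex on its far side, so nothing can be added to the fan. Fans are the triangulations that
  force a blocking set to reach every vertex.\<close>

lemma tri_fan:
  assumes "v < n"
  shows "tri n {e \<in> diagonals n. v \<in> e}"
proof (rule triI)
  fix e f assume "e \<in> {e \<in> diagonals n. v \<in> e}" "f \<in> {e \<in> diagonals n. v \<in> e}"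
  then show "\<not> interleaved e f" unfolding interleaved_def by auto
next
  fix e assume e: "e \<in> diagonals n"
    and no: "\<And>f. f \<in> {e \<in> diagonals n. v \<in> e} \<Longrightarrow> \<not> interleaved e f"
  \<comment> \<open>An edge that crosses another edge is a diagonal, so any vertex on the far side
    may serve as \<open>x\<close>.\<close>
  have no': "\<not> interleaved e {v, x}" if "x < n" "x \<noteq> v" for x
  proof
    assume i: "interleaved e {v, x}"
    have "{v, x} \<in> edges n" "e \<in> edges n"
      using that assms e diagonals_subset_edges by auto
    then have "{v, x} \<in> diagonals n"
      using interleaved_sym[OF i] unfolding diagonal_iff_interleaved by blast
    then show False using no[of "{v, x}"] i by simp
  qed
  obtain i j where ij: "e = {i, j}" "i < j" "j < n"
    using e diagonals_subset_edges by (meson edgesE subsetD)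
  have d: "Suc i < j" "i = 0 \<longrightarrow> Suc j < n" using e ij by (auto simp: doubleton_in_diagonals)
  have "v \<in> e"
  proof (rule ccontr)
    assume v: "v \<notin> e"
    consider "v < i" | "j < v" | "i < v" "v < j" "i = 0" | "i < v" "v < j" "i > 0"
      using v ij by force
    then show False
    proof cases
      case 1
      then have "interleaved e {v, Suc i}" using ij d by (simp add: interleaved_doubletons)
      then show False using no'[of "Suc i"] 1 ij d by simp
    next
      case 2
      then have "interleaved e {Suc i, v}" using ij d by (simp add: interleaved_doubletons)
      then show False using no'[of "Suc i"] 2 ij d by (simp add: insert_commute)
    next
      case 3
      then have "interleaved e {v, Suc j}" using ij d by (simp add: interleaved_doubletons)
      then show False using no'[of "Suc j"] 3 ij d by simp
    next
      case 4
      then have "interleaved e {0, v}" using ij d by (simp add: interleaved_doubletons)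
      then show False using no'[of 0] 4 ij d by (simp add: insert_commute)
    qed
  qed
  then show "e \<in> {e \<in> diagonals n. v \<in> e}" using e by simp
qed auto

text \<open>Take a chord of least span, admitting the side \<open>{0, n - 1}\<close> so that one
  exists. A member of \<open>T\<close> crossing \<open>{i, i + 2}\<close> ends at
  \<open>i + 1\<close>, so it would have smaller span or cross the chosen chord. The ear
  \<open>v + 1\<close> found is neither \<open>0\<close> nor \<open>n - 1\<close>, so its deletion
  involves no wrap-around of labels.\<close>

lemma tri_ear_exists:
  assumes T: "tri n T" and n: "n \<ge> 4"
  shows "\<exists>v. v + 2 < n \<and> {v, v + 2} \<in> T"
proof -
  define Q where "Q p \<longleftrightarrow> fst p + 2 \<le> snd p \<and> snd p < n \<and>
    ({fst p, snd p} \<in> T \<or> fst p = 0 \<and> snd p = n - 1)" for p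
  have "Q (0, n - 1)" using n by (auto simp: Q_def)
  then obtain i j where Q: "Q (i, j)" and min: "\<And>p. Q p \<Longrightarrow> j - i \<le> snd p - fst p"
    using ex_has_least_nat[of Q _ "\<lambda>p. snd p - fst p"] by (metis fst_conv snd_conv surj_pair)
  have ij: "i + 2 \<le> j" "j < n" "{i, j} \<in> T \<or> i = 0 \<and> j = n - 1"
    using Q by (auto simp: Q_def)
  have "{i, i + 2} \<in> T"
  proof (cases "j = i + 2")
    case True
    then show ?thesis using ij n by auto
  next
    case False
    then have d: "{i, i + 2} \<in> diagonals n"
      using ij n by (subst doubleton_in_diagonals) auto
    show ?thesis
    proof (rule ccontr)
      assume "{i, i + 2} \<notin> T"
      then obtain f where f: "f \<in> T" "interleaved {i, i + 2} f" using triD(4)[OF T d] by blast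
      obtain k l where kl: "f = {k, l}" "k < l" "l < n"
        using triD(2)[OF T f(1)] by (rule edgesE)
      have "i < k \<and> k < i + 2 \<and> i + 2 < l \<or> k < i \<and> i < l \<and> l < i + 2"
        using f(2) kl by (simp add: interleaved_doubletons)
      then consider "k = Suc i" "i + 2 < l" | "k < i" "l = Suc i" by force
      then show False
      proof cases
        case 1
        show False
        proof (cases "l \<le> j")
          case True
          then have "Q (k, l)" using 1 kl f by (auto simp: Q_def)
          from min[OF this] show False using 1 True by simp
        next
          case False
          then have "interleaved {i, j} f" using 1 kl ij by (simp add: interleaved_doubletons)
          then show False using triD(3)[OF T, of "{i, j}" f] f ij False kl by auto
        qed
      next
        case 2
        then have "interleaved {i, j} f" using kl ij by (simp add: interleaved_doubletons)
        then show False using triD(3)[OF T, of "{i, j}" f] f ij 2 by auto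
      qed
    qed
  qed
  moreover have "i + 2 < n" using ij n by simp
  ultimately show ?thesis by blast
qed

text \<open>\<open>skip q\<close> relabels the polygon with vertex \<open>q\<close> deleted.\<close>

definition skip :: "nat \<Rightarrow> nat \<Rightarrow> nat" where
  "skip q x = (if x < q then x else Suc x)"

lemma skip_less_iff [simp]: "skip q x < skip q y \<longleftrightarrow> x < y"
  by (auto simp: skip_def)

lemma skip_eq_iff [simp]: "skip q x = skip q y \<longleftrightarrow> x = y"
  by (auto simp: skip_def)

lemma skip_neq [simp]: "skip q x \<noteq> q" "q \<noteq> skip q x"
  by (auto simp: skip_def)

lemma skip_surj: "x \<noteq> q \<Longrightarrow> x < Suc n \<Longrightarrow> q < Suc n \<Longrightarrow> \<exists>y<n. x = skip q y"
  by (cases "x < q") (auto simp: skip_def intro!: exI[of _ "if x < q then x else x - 1"])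

lemma interleaved_skip:
  assumes "e \<in> edges n" "f \<in> edges n"
  shows "interleaved (skip q ` e) (skip q ` f) \<longleftrightarrow> interleaved e f"
  using assms by (auto simp: edges_iff interleaved_doubletons)

text \<open>A diagonal at the cut vertex \<open>Suc v\<close> would cross the ear diagonal, so
  \<open>T\<close> contains none. Every member of \<open>T\<close> therefore descends to the smaller
  polygon, and one that becomes a side, as the ear diagonal does, crosses nothing there. Hence
  maximality is inherited.\<close>

lemma tri_delete_ear:
  assumes T: "tri (Suc n) T" and v: "v + 2 \<le> n" and ear: "{v, v + 2} \<in> T"
  shows "tri n {e \<in> diagonals n. skip (Suc v) ` e \<in> T}" (is "tri n ?T")
proof (rule triI)
  fix e f assume "e \<in> ?T" "f \<in> ?T"
  then show "\<not> interleaved e f"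
    using triD(3)[OF T, of "skip (Suc v) ` e" "skip (Suc v) ` f"] interleaved_skip[of e n f "Suc v"]
      diagonals_subset_edges by auto
next
  fix e assume e: "e \<in> diagonals n" and no: "\<And>f. f \<in> ?T \<Longrightarrow> \<not> interleaved e f"
  obtain i j where ij: "e = {i, j}" "i < j" "j < n"
    using e diagonals_subset_edges by (meson edgesE subsetD)
  have d: "Suc i < j" "i = 0 \<longrightarrow> Suc j < n" using e ij by (auto simp: doubleton_in_diagonals)
  have "skip (Suc v) ` e \<in> diagonals (Suc n)"
    using ij d by (simp add: doubleton_in_diagonals) (auto simp: skip_def)
  moreover have "\<not> interleaved (skip (Suc v) ` e) g" if g: "g \<in> T" for g
  proof (cases "Suc v \<in> g")
    case True
    obtain a b where ab: "g = {a, b}" "a < b" "b < Suc n"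
      using triD(2)[OF T g] by (rule edgesE)
    have "Suc a < b" using triD(1)[OF T g] ab by (simp add: doubleton_in_diagonals)
    with True ab have "interleaved {v, v + 2} g" by (auto simp: interleaved_doubletons)
    then show ?thesis using triD(3)[OF T ear g] by simp
  next
    case False
    obtain a b where ab: "g = {a, b}" "a < b" "b < Suc n"
      using triD(2)[OF T g] by (rule edgesE)
    obtain a' b' where ab': "a = skip (Suc v) a'" "b = skip (Suc v) b'" "a' < n" "b' < n"
      using False ab v skip_surj[of a "Suc v" n] skip_surj[of b "Suc v" n] by auto
    define f where "f = {a', b'}"
    have f: "f \<in> edges n" "g = skip (Suc v) ` f" using ab ab' by (auto simp: f_def)
    show ?thesis
    proof (cases "f \<in> diagonals n")
      case True
      then show ?thesis
        using no[of f] g f interleaved_skip[of e n f "Suc v"] e diagonals_subset_edges by auto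
    next
      case False
      then have "\<not> interleaved e f"
        using f e diagonals_subset_edges unfolding diagonal_iff_interleaved
        by (meson interleaved_sym)
      then show ?thesis
        using f interleaved_skip[of e n f "Suc v"] e diagonals_subset_edges by auto
    qed
  qed
  ultimately have "skip (Suc v) ` e \<in> T" using triD(4)[OF T] by blast
  then show "e \<in> ?T" using e by simp
qed auto

text \<open>The new vertex \<open>n\<close> sits between \<open>n - 1\<close> and \<open>0\<close>,
  whose common side becomes a diagonal; every diagonal that ends at \<open>n\<close> crosses
  it.\<close>

lemma tri_insert_ear:
  assumes T: "tri n T" and n: "n \<ge> 3"
  shows "tri (Suc n) (insert {0, n - 1} T)"
proof (rule triI)
  have d: "diagonals n \<subseteq> diagonals (Suc n)"
  proof
    fix e assume "e \<in> diagonals n"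
    then show "e \<in> diagonals (Suc n)"
      using edges_mono[of n "Suc n"] by (auto simp: diagonal_iff_interleaved)
  qed
  fix e assume "e \<in> insert {0, n - 1} T"
  then show "e \<in> diagonals (Suc n)"
    using triD(1)[OF T, of e] d n by (auto simp: doubleton_in_diagonals)
next
  have no: "\<not> interleaved {0, n - 1} f" if f: "f \<in> T" for f
  proof -
    obtain a b where "f = {a, b}" "a < b" "b < n" using triD(2)[OF T f] by (rule edgesE)
    then show ?thesis using n by (auto simp: interleaved_doubletons)
  qed
  have no': "\<not> interleaved f {0, n - 1}" if "f \<in> T" for f
    using no[OF that] interleaved_sym[of f "{0, n - 1}"] by blast
  fix e f assume "e \<in> insert {0, n - 1} T" "f \<in> insert {0, n - 1} T"
  then show "\<not> interleaved e f"
    using no no' triD(3)[OF T, of e f] by auto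
next
  fix e assume e: "e \<in> diagonals (Suc n)"
    and no: "\<And>f. f \<in> insert {0, n - 1} T \<Longrightarrow> \<not> interleaved e f"
  obtain i j where ij: "e = {i, j}" "i < j" "j < Suc n"
    using e diagonals_subset_edges by (meson edgesE subsetD)
  have d: "Suc i < j" "i = 0 \<longrightarrow> j < n" using e ij by (auto simp: doubleton_in_diagonals)
  have "j < n"
  proof (rule ccontr)
    assume "\<not> j < n"
    then have "interleaved e {0, n - 1}" using ij d n by (auto simp: interleaved_doubletons)
    then show False using no by simp
  qed
  show "e \<in> insert {0, n - 1} T"
  proof (cases "e \<in> diagonals n")
    case True
    then show ?thesis using triD(4)[OF T] no by blast
  next
    case False
    then show ?thesis using ij d \<open>j < n\<close> by (auto simp: doubleton_in_diagonals)
  qed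
qed

subsection \<open>Rotations\<close>

definition rot :: "nat \<Rightarrow> nat \<Rightarrow> nat \<Rightarrow> nat" where
  "rot n r v = (v + r) mod n"

lemma shift_eq_rot: "shift n r B = image (rot n r) ` B"
  by (simp add: shift_def rot_def)

lemma rot_rot: "rot n r (rot n s v) = rot n (s + r) v"
  by (simp add: rot_def mod_add_left_eq add.assoc)

lemma rot_less [simp]: "v < n \<Longrightarrow> rot n r v < n"
  by (simp add: rot_def)

lemma rot_id: "v < n \<Longrightarrow> n dvd r \<Longrightarrow> rot n r v = v"
  by (elim dvdE) (simp add: rot_def)

lemma rot_image_id: "e \<in> edges n \<Longrightarrow> n dvd r \<Longrightarrow> rot n r ` e = e"
  by (auto simp: edges_def rot_id)

lemma rot_inverse:
  assumes "v < n"
  shows "rot n (n - r mod n) (rot n r v) = v"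
proof -
  have "r mod n \<le> n" using assms by (simp add: less_imp_le)
  then have "r + (n - r mod n) = (r - r mod n) + n" by simp
  also have "\<dots> = n * (r div n + 1)" by (simp add: minus_mod_eq_mult_div)
  finally show ?thesis using assms by (simp add: rot_rot rot_id)
qed

lemma rot_image_inverse:
  assumes "e \<in> edges n"
  shows "rot n (n - r mod n) ` rot n r ` e = e"
proof -
  have "(\<lambda>v. rot n (n - r mod n) (rot n r v)) ` e = (\<lambda>v. v) ` e"
    using edges_subset[OF assms] by (intro image_cong) (auto simp: rot_inverse)
  then show ?thesis by (simp only: image_image image_ident)
qed

lemma rot_eq_iff:
  assumes "u < n" "v < n"
  shows "rot n r u = rot n r v \<longleftrightarrow> u = v"
  using rot_inverse[OF assms(1), of r] rot_inverse[OF assms(2), of r] by metis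

lemma rot_edges: "e \<in> edges n \<Longrightarrow> rot n r ` e \<in> edges n"
  by (erule edgesE) (simp add: rot_eq_iff)

lemma shift_edges: "B \<subseteq> edges n \<Longrightarrow> shift n r B \<subseteq> edges n"
  unfolding shift_eq_rot using rot_edges by blast

lemma shift_shift: "shift n r (shift n s B) = shift n (s + r) B"
  by (simp add: shift_eq_rot image_image rot_rot)

lemma shift_id:
  assumes "B \<subseteq> edges n" "n dvd r"
  shows "shift n r B = B"
proof -
  have "image (rot n r) ` B = (\<lambda>e. e) ` B"
    using assms by (intro image_cong[OF refl]) (simp add: rot_image_id subset_iff)
  then show ?thesis by (simp only: shift_eq_rot image_ident)
qed

lemma shift_inverse:
  assumes "B \<subseteq> edges n"
  shows "shift n (n - r mod n) (shift n r B) = B"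
proof -
  have "(\<lambda>e. rot n (n - r mod n) ` rot n r ` e) ` B = (\<lambda>e. e) ` B"
    using assms by (intro image_cong[OF refl] rot_image_inverse) blast
  then show ?thesis by (simp only: shift_eq_rot image_image[of "image _"] image_ident)
qed

lemma shift_inverse':
  assumes "B \<subseteq> edges n"
  shows "shift n r (shift n (n - r mod n) B) = B"
proof -
  have "shift n r (shift n (n - r mod n) B) = shift n (n - r mod n) (shift n r B)"
    by (simp only: shift_shift add.commute)
  then show ?thesis using shift_inverse[OF assms] by simp
qed

lemma card_shift:
  assumes "B \<subseteq> edges n"
  shows "card (shift n r B) = card B"
  unfolding shift_eq_rot
proof (rule card_image, rule inj_onI)
  fix e f assume "e \<in> B" "f \<in> B" "rot n r ` e = rot n r ` f"
  then show "e = f"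
    using rot_image_inverse assms by (metis subsetD)
qed

text \<open>The order pattern changes only when the largest label wraps to \<open>0\<close>, and
  then the two edges just exchange roles.\<close>

lemma interleaved_rot_Suc_0:
  assumes "e \<in> edges n" "f \<in> edges n" "interleaved e f"
  shows "interleaved (rot n 1 ` e) (rot n 1 ` f)"
proof -
  have main: "interleaved (rot n 1 ` {a, c}) (rot n 1 ` {b, d})"
    if "a < b" "b < c" "c < d" "d < n" for a b c d
  proof (cases "Suc d = n")
    case True
    then have "rot n 1 ` {a, c} = {Suc a, Suc c}" "rot n 1 ` {b, d} = {0, Suc b}"
      using that by (auto simp: rot_def)
    then show ?thesis using that by (simp add: interleaved_doubletons)
  next
    case False
    then have "rot n 1 ` {a, c} = {Suc a, Suc c}" "rot n 1 ` {b, d} = {Suc b, Suc d}"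
      using that by (auto simp: rot_def)
    then show ?thesis using that by (simp add: interleaved_doubletons)
  qed
  obtain a b c d where "a < b" "b < c" "c < d"
    and ef: "e = {a, c} \<and> f = {b, d} \<or> e = {b, d} \<and> f = {a, c}"
    using assms(3) unfolding interleaved_def by blast
  moreover from ef have "d < n" using assms(1,2) by auto
  ultimately show ?thesis using main[of a b c d] interleaved_sym[OF main[of a b c d]] by auto
qed

lemma interleaved_rot:
  assumes "e \<in> edges n" "f \<in> edges n" "interleaved e f"
  shows "interleaved (rot n r ` e) (rot n r ` f)"
proof (induction r)
  case 0
  then show ?case using assms by (simp add: rot_image_id)
next
  case (Suc r)
  then show ?case
    using interleaved_rot_Suc_0[OF rot_edges[OF assms(1)] rot_edges[OF assms(2)], of r r]
    by (simp add: image_image rot_rot)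
qed

lemma tri_shift:
  assumes T: "tri n T"
  shows "tri n (shift n r T)"
proof -
  have E: "T \<subseteq> edges n" using triD(2)[OF T] by blast
  have diag: "rot n r ` e \<in> diagonals n" if "e \<in> diagonals n" for e r
    using that unfolding diagonal_iff_interleaved by (meson interleaved_rot rot_edges)
  show ?thesis
  proof (rule triI)
    fix e assume "e \<in> shift n r T"
    then show "e \<in> diagonals n" using triD(1)[OF T] diag by (auto simp: shift_eq_rot)
  next
    fix e f assume "e \<in> shift n r T" "f \<in> shift n r T"
    then obtain e' f' where ef: "e' \<in> T" "f' \<in> T" "e = rot n r ` e'" "f = rot n r ` f'"
      by (auto simp: shift_eq_rot)
    then have "e' \<in> edges n" "f' \<in> edges n" using E by auto
    then have "interleaved e f \<Longrightarrow> interleaved e' f'"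
      using interleaved_rot[of e n f "n - r mod n"] rot_image_inverse ef by (simp add: rot_edges)
    then show "\<not> interleaved e f" using triD(3)[OF T] ef by blast
  next
    fix e assume e: "e \<in> diagonals n" and no: "\<And>f. f \<in> shift n r T \<Longrightarrow> \<not> interleaved e f"
    define e' where "e' = rot n (n - r mod n) ` e"
    have e'd: "e' \<in> diagonals n" using e diag by (simp add: e'_def)
    have ee: "rot n r ` e' = e"
      using e diagonals_subset_edges rot_image_inverse[of e n r]
      by (auto simp: e'_def image_image rot_rot add.commute)
    have "\<not> interleaved e' f" if "f \<in> T" for f
      using no[of "rot n r ` f"] interleaved_rot[of e' n f r] e'd ee E that diagonals_subset_edges
      by (auto simp: shift_eq_rot)
    then have "e' \<in> T" using triD(4)[OF T e'd] by blast
    then show "e \<in> shift n r T" using ee by (auto simp: shift_eq_rot)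
  qed
qed

subsection \<open>Blocking sets\<close>

definition blocks :: "nat \<Rightarrow> nat set set \<Rightarrow> bool" where
  "blocks n B \<longleftrightarrow> B \<subseteq> edges n \<and> (\<forall>T. tri n T \<longrightarrow> B \<inter> T \<noteq> {})"

lemma blocking_set_iff_blocks:
  "clockwise_ngon n P \<Longrightarrow> blocking_set n P B \<longleftrightarrow> blocks n B"
  by (simp add: blocking_set_def blocks_def triangulation_iff_tri)

lemma blocks_edges: "blocks n B \<Longrightarrow> B \<subseteq> edges n"
  by (simp add: blocks_def)

lemma blocks_finite: "blocks n B \<Longrightarrow> finite B"
  by (meson blocks_edges finite_edges finite_subset)

lemma blocks_shift:
  assumes B: "blocks n B"
  shows "blocks n (shift n r B)"
  unfolding blocks_def
proof (intro conjI allI impI)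
  show "shift n r B \<subseteq> edges n" using B blocks_edges shift_edges by blast
  fix T assume T: "tri n T"
  then have "B \<inter> shift n (n - r mod n) T \<noteq> {}" using B tri_shift unfolding blocks_def by blast
  then obtain e where e: "e \<in> B" "e \<in> shift n (n - r mod n) T" by blast
  then have "rot n r ` e \<in> shift n r (shift n (n - r mod n) T)" by (auto simp: shift_eq_rot)
  then have "rot n r ` e \<in> T" using shift_inverse' triD(2)[OF T] by (metis subsetI)
  then show "shift n r B \<inter> T \<noteq> {}" using e by (auto simp: shift_eq_rot)
qed

lemma blocks_fan:
  assumes "blocks n B" "v < n"
  shows "\<exists>e\<in>B. v \<in> e"
  using assms tri_fan[of v n] unfolding blocks_def by blast

lemma blocks_remove_last:
  assumes B: "blocks (Suc n) B" and n: "n \<ge> 3" and ear: "{0, n - 1} \<notin> B"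
  shows "blocks n {e \<in> B. n \<notin> e}"
  unfolding blocks_def
proof (intro conjI allI impI)
  show "{e \<in> B. n \<notin> e} \<subseteq> edges n"
    using blocks_edges[OF B] by (auto simp: edges_iff subset_iff less_Suc_eq)
  fix T assume T: "tri n T"
  obtain e where "e \<in> B" "e \<in> insert {0, n - 1} T"
    using B tri_insert_ear[OF T n] unfolding blocks_def by blast
  then show "{e \<in> B. n \<notin> e} \<inter> T \<noteq> {}"
    using ear triD(2)[OF T] edges_subset[of e n] by auto
qed

subsection \<open>Blockers\<close>

lemma rot_1: "v < n \<Longrightarrow> rot n (Suc 0) v = (if Suc v = n then 0 else Suc v)"
  by (auto simp: rot_def)

lemma rot_minus_1: "v < n \<Longrightarrow> rot n (n - Suc 0) v = (if v = 0 then n - 1 else v - 1)"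
proof -
  assume v: "v < n"
  show ?thesis
  proof (cases "v = 0")
    case False
    then obtain w where w: "v = Suc w" by (cases v) auto
    then have eq: "v + (n - Suc 0) = w + n" using v by simp
    show ?thesis unfolding rot_def eq using w v by simp
  qed (use v in \<open>simp add: rot_def\<close>)
qed

lemma rot_commute: "rot n r (rot n s v) = rot n s (rot n r v)"
  by (simp only: rot_rot add.commute)

lemma rot_reaches:
  assumes "v < n" "w < n"
  shows "\<exists>r. rot n r v = w"
proof
  have "v + (n - v + w) = w + n" using assms by simp
  then show "rot n (n - v + w) v = w" using assms by (simp add: rot_def)
qed

lemma mem_shift_iff:
  assumes "B \<subseteq> edges n" "e \<in> edges n"
  shows "rot n r ` e \<in> shift n r B \<longleftrightarrow> e \<in> B"
proof
  assume "rot n r ` e \<in> shift n r B"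
  then obtain f where "f \<in> B" "rot n r ` e = rot n r ` f" by (auto simp: shift_eq_rot)
  then show "e \<in> B" using rot_image_inverse assms by (metis subsetD)
qed (simp add: shift_eq_rot)

definition ear :: "nat \<Rightarrow> nat set set \<Rightarrow> nat \<Rightarrow> bool" where
  "ear n B v \<longleftrightarrow> {rot n (n - 1) v, rot n 1 v} \<in> B"

lemma ear_shift:
  assumes "B \<subseteq> edges n" "v < n" "n \<ge> 3"
  shows "ear n (shift n r B) (rot n r v) \<longleftrightarrow> ear n B v"
proof -
  have "{rot n (n - 1) v, rot n 1 v} \<in> edges n"
    using assms by (auto simp: rot_1 rot_minus_1)
  moreover have "{rot n (n - 1) (rot n r v), rot n 1 (rot n r v)} = rot n r ` {rot n (n - 1) v, rot n 1 v}"
    by (simp add: rot_commute[of n r])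
  ultimately show ?thesis
    using mem_shift_iff[OF assms(1), of "{rot n (n - 1) v, rot n 1 v}" r] by (simp only: ear_def)
qed

lemma ear_last: "n \<ge> 1 \<Longrightarrow> ear (Suc n) B n \<longleftrightarrow> {0, n - 1} \<in> B"
  by (simp add: ear_def rot_1 rot_minus_1[of n "Suc n", simplified] insert_commute)

lemma ear_0: "n \<ge> 2 \<Longrightarrow> ear n B 0 \<longleftrightarrow> {1, n - 1} \<in> B"
  by (simp add: ear_def rot_1[of 0 n, simplified] rot_minus_1[of 0 n, simplified] insert_commute)

lemma ear_mid: "0 < v \<Longrightarrow> Suc v < n \<Longrightarrow> ear n B v \<longleftrightarrow> {v - 1, Suc v} \<in> B"
  by (simp add: ear_def rot_1 rot_minus_1[of v n, simplified])

lemma not_ear_shift_last: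
  assumes "B \<subseteq> edges (Suc n)" "v < Suc n" "n \<ge> 2" "\<not> ear (Suc n) B v" "rot (Suc n) r v = n"
  shows "{0, n - 1} \<notin> shift (Suc n) r B"
proof -
  have "\<not> ear (Suc n) (shift (Suc n) r B) n"
    using ear_shift[OF assms(1,2), of r] assms(3-5) by simp
  then show ?thesis using ear_last[of n] assms(3) by simp
qed

lemma ex_not_ear:
  assumes n: "n \<ge> 5" and B: "finite B" "card B < n"
  shows "\<exists>v<n. \<not> ear n B v"
proof (rule ccontr)
  assume "\<not> ?thesis"
  then have "(\<lambda>v. {rot n (n - 1) v, rot n 1 v}) ` {..<n} \<subseteq> B" by (auto simp: ear_def)
  moreover have "inj_on (\<lambda>v. {rot n (n - 1) v, rot n 1 v}) {..<n}"
    using n by (intro inj_onI) (auto simp: doubleton_eq_iff rot_1 rot_minus_1 split: if_splits)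
  ultimately have "n \<le> card B" using B(1) card_inj_on_le by (metis card_lessThan)
  then show False using B(2) by simp
qed

text \<open>In a quadrilateral each fan consists of a single diagonal, so both diagonals are
  forced.\<close>

lemma blocks_4:
  assumes "blocks 4 B"
  shows "{0, 2} \<in> B" "{1, 3} \<in> B"
proof -
  have fan: "\<exists>e\<in>B. e \<in> diagonals 4 \<and> v \<in> e" if "v < 4" for v
    using assms tri_fan[OF that] unfolding blocks_def by blast
  have diag: "e = {0, 2} \<or> e = {1, 3}" if e: "e \<in> diagonals 4" for e
  proof -
    obtain i j where "e = {i, j}" "i < j" "j < 4"
      using e diagonals_subset_edges by (meson edgesE subsetD)
    moreover have "i = 0 \<or> i = 1 \<or> i = 2 \<or> i = 3" "j = 0 \<or> j = 1 \<or> j = 2 \<or> j = 3"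
      using calculation by auto
    ultimately show ?thesis using e by (auto simp: doubleton_in_diagonals)
  qed
  show "{0, 2} \<in> B" using fan[of 0] diag by fastforce
  show "{1, 3} \<in> B" using fan[of 1] diag by fastforce
qed

lemma card_split_last:
  "finite B \<Longrightarrow> card B = card {e \<in> B. n \<notin> e} + card {e \<in> B. n \<in> e}" for n :: nat
  by (subst card_Un_disjoint[symmetric]) (auto intro!: arg_cong[of _ _ card])

text \<open>A set with at least as many edges as vertices satisfies the bound trivially; any other
  set has a non-ear. Rotated to the last label and deleted, it takes at least one edge with it,
  because the fan there is blocked.\<close>

lemma blocks_card_ge:
  assumes "blocks n B" "n \<ge> 4"
  shows "n - 2 \<le> card B"
  using assms(2,1)
proof (induction n arbitrary: B rule: dec_induct)
  case base
  have "{{0, 2}, {1, 3}} \<subseteq> B" using blocks_4[OF base] by simp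
  then have "card {{0, 2::nat}, {1, 3}} \<le> card B"
    by (rule card_mono[OF blocks_finite[OF base]])
  then show ?case by (simp add: doubleton_eq_iff)
next
  case (step n)
  show ?case
  proof (cases "card B < Suc n")
    case True
    then obtain v where v: "v < Suc n" "\<not> ear (Suc n) B v"
      using ex_not_ear[of "Suc n" B] step blocks_finite by auto
    obtain r where r: "rot (Suc n) r v = n" using rot_reaches[of v "Suc n" n] v by auto
    define C where "C = shift (Suc n) r B"
    have C: "blocks (Suc n) C" using step blocks_shift by (simp add: C_def)
    have "{0, n - 1} \<notin> C"
      unfolding C_def using not_ear_shift_last[OF blocks_edges[OF step.prems] v(1) _ v(2) r] step.hyps by simp
    then have "blocks n {e \<in> C. n \<notin> e}" using blocks_remove_last[OF C] step by simp
    then have "n - 2 \<le> card {e \<in> C. n \<notin> e}" using step by simp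
    moreover have "{e \<in> C. n \<in> e} \<noteq> {}" using blocks_fan[OF C, of n] by auto
    then have "card {e \<in> C. n \<in> e} > 0" using blocks_finite[OF C] by (simp add: card_gt_0_iff)
    moreover have "card B = card C"
      using blocks_edges[OF step.prems] by (simp add: C_def card_shift)
    ultimately show ?thesis using card_split_last[OF blocks_finite[OF C], of n] by simp
  qed simp
qed

section \<open>Blocking sets that attain the lower bound\<close>

definition tight :: "nat \<Rightarrow> nat set set \<Rightarrow> bool" where
  "tight n B \<longleftrightarrow> blocks n B \<and> card B = n - 2"

lemma tight_blocks: "tight n B \<Longrightarrow> blocks n B"
  by (simp add: tight_def)

lemma tight_edges: "tight n B \<Longrightarrow> B \<subseteq> edges n"
  by (simp add: tight_def blocks_edges)

lemma tight_finite: "tight n B \<Longrightarrow> finite B"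
  using blocks_finite by (auto simp: tight_def)

lemma tight_shift: "tight n B \<Longrightarrow> tight n (shift n r B)"
  by (simp add: tight_def blocks_shift card_shift blocks_edges)

lemma tight_ex_not_ear: "tight n B \<Longrightarrow> n \<ge> 5 \<Longrightarrow> \<exists>v<n. \<not> ear n B v"
  using ex_not_ear[of n B] tight_finite[of n B] by (simp add: tight_def)

text \<open>The lower bound in the smaller polygon leaves room for a single edge at the deleted
  vertex, so equality holds throughout.\<close>

lemma tight_remove_last:
  assumes B: "tight (Suc n) B" and n: "n \<ge> 4" and ear: "{0, n - 1} \<notin> B"
  shows "tight n {e \<in> B. n \<notin> e}" "\<exists>e. {e \<in> B. n \<in> e} = {e}"
proof -
  have b: "blocks n {e \<in> B. n \<notin> e}"
    using blocks_remove_last[OF tight_blocks[OF B]] n ear by simp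
  have "n - 2 \<le> card {e \<in> B. n \<notin> e}" using blocks_card_ge[OF b] n by simp
  moreover have "{e \<in> B. n \<in> e} \<noteq> {}" using blocks_fan[OF tight_blocks[OF B], of n] by auto
  then have "card {e \<in> B. n \<in> e} > 0" using tight_finite[OF B] by (simp add: card_gt_0_iff)
  moreover have "card B = n - 1" using B by (simp add: tight_def)
  ultimately have "card {e \<in> B. n \<notin> e} = n - 2" "card {e \<in> B. n \<in> e} = 1"
    using card_split_last[OF tight_finite[OF B], of n] n by auto
  then show "tight n {e \<in> B. n \<notin> e}" "\<exists>e. {e \<in> B. n \<in> e} = {e}"
    using b by (auto simp: tight_def card_1_singleton_iff)
qed

lemma not_ear_edge_unique:
  assumes B: "tight (Suc n) B" and n: "n \<ge> 4"
    and v: "v < Suc n" "\<not> ear (Suc n) B v"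
    and ef: "e \<in> B" "f \<in> B" "v \<in> e" "v \<in> f"
  shows "e = f"
proof -
  obtain r where r: "rot (Suc n) r v = n" using rot_reaches[of v "Suc n" n] v by auto
  define C where "C = shift (Suc n) r B"
  have C: "tight (Suc n) C" using B tight_shift by (simp add: C_def)
  have "{0, n - 1} \<notin> C"
    unfolding C_def using not_ear_shift_last[OF tight_edges[OF B] v(1) _ v(2) r] n by simp
  then obtain g where g: "{e \<in> C. n \<in> e} = {g}" using tight_remove_last[OF C n] by blast
  have "rot (Suc n) r ` e \<in> {e \<in> C. n \<in> e}" "rot (Suc n) r ` f \<in> {e \<in> C. n \<in> e}"
    using ef imageI[OF ef(3), of "rot (Suc n) r"] imageI[OF ef(4), of "rot (Suc n) r"] r
    by (simp_all add: C_def shift_eq_rot)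
  then have "rot (Suc n) r ` e = rot (Suc n) r ` f" using g by auto
  then show ?thesis using rot_image_inverse tight_edges[OF B] ef by (metis subsetD)
qed

text \<open>Deleting \<open>u\<close> would leave \<open>v\<close> isolated, and the fan at \<open>v\<close> unblocked.\<close>

lemma not_ear_no_edge:
  assumes B: "tight (Suc n) B" and n: "n \<ge> 4"
    and u: "u < Suc n" "\<not> ear (Suc n) B u" and v: "v < Suc n" "\<not> ear (Suc n) B v"
  shows "{u, v} \<notin> B"
proof
  assume uv: "{u, v} \<in> B"
  then have "{u, v} \<in> edges (Suc n)" using tight_edges[OF B] by blast
  then have "u \<noteq> v" by simp
  obtain r where r: "rot (Suc n) r u = n" using rot_reaches[of u "Suc n" n] u by auto
  define C where "C = shift (Suc n) r B"
  define w where "w = rot (Suc n) r v"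
  have C: "tight (Suc n) C" using B tight_shift by (simp add: C_def)
  have "{0, n - 1} \<notin> C"
    unfolding C_def using not_ear_shift_last[OF tight_edges[OF B] u(1) _ u(2) r] n by simp
  then have C': "tight n {e \<in> C. n \<notin> e}" using tight_remove_last[OF C n] by blast
  have w: "w < Suc n" "\<not> ear (Suc n) C w"
    using ear_shift[OF tight_edges[OF B] v(1)] v n by (auto simp: C_def w_def)
  have "w \<noteq> n" using r \<open>u \<noteq> v\<close> u v rot_eq_iff[of u "Suc n" v r] by (auto simp: w_def)
  then obtain e where e: "e \<in> C" "n \<notin> e" "w \<in> e"
    using blocks_fan[OF tight_blocks[OF C'], of w] w by auto
  have "{n, w} \<in> C"
    using uv r by (auto simp: C_def w_def shift_eq_rot intro!: image_eqI[of _ _ "{u, v}"])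
  then have "e = {n, w}" using not_ear_edge_unique[OF C n w e(1) _ e(3)] by simp
  then show False using e by simp
qed

text \<open>Every edge of \<open>B\<close> ends at an ear, and not all vertices are ears; so
  somewhere on the way round an ear is followed by a non-ear. These two are rotated to
  \<open>n - 1\<close> and \<open>n\<close>, and the diagonal \<open>{n - 2, n}\<close> that makes
  \<open>n - 1\<close> an ear is then the only edge at \<open>n\<close>.\<close>

lemma tight_normalize:
  assumes B: "tight (Suc n) B" and n: "n \<ge> 4"
  obtains r C where "C = shift (Suc n) r B" "tight n {e \<in> C. n \<notin> e}" "{e \<in> C. n \<in> e} = {{n - 2, n}}"
proof -
  let ?N = "Suc n"
  have step: "\<exists>v<?N. ear ?N B v \<and> \<not> ear ?N B (rot ?N 1 v)"
  proof (rule ccontr)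
    assume no: "\<not> ?thesis"
    have "B \<noteq> {}" using B n by (auto simp: tight_def)
    then obtain i j where "{i, j} \<in> B" "i < ?N" "j < ?N"
      using tight_edges[OF B] by (metis all_not_in_conv edges_iff order.strict_trans subsetD)
    then obtain x where x: "x < ?N" "ear ?N B x" using not_ear_no_edge[OF B n, of i j] by blast
    have all: "ear ?N B (rot ?N k x)" for k
    proof (induction k)
      case 0
      then show ?case using x by (simp add: rot_id)
    next
      case (Suc k)
      then have "ear ?N B (rot ?N 1 (rot ?N k x))" using no x by auto
      then show ?case by (simp add: rot_rot)
    qed
    obtain y where "y < ?N" "\<not> ear ?N B y" using tight_ex_not_ear[OF B] n by auto
    then show False using all rot_reaches[OF x(1)] by metis
  qed
  then obtain v where v: "v < ?N" "ear ?N B v" "\<not> ear ?N B (rot ?N 1 v)" by blast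
  have "n - 1 < ?N" by simp
  then obtain r where r: "rot ?N r v = n - 1" using rot_reaches[OF v(1)] by blast
  define C where "C = shift ?N r B"
  have C: "tight ?N C" using B tight_shift by (simp add: C_def)
  have "ear ?N C (n - 1)" using ear_shift[OF tight_edges[OF B] v(1), of r] v r n by (simp add: C_def)
  then have 1: "{n - 2, n} \<in> C" using ear_mid[of "n - 1" ?N C] n by (simp add: numeral_2_eq_2)
  have "rot ?N r (rot ?N 1 v) = n" using r n rot_commute[of ?N r 1 v] rot_1[of "n - 1" ?N] by simp
  then have "\<not> ear ?N C n"
    using ear_shift[OF tight_edges[OF B], of "rot ?N 1 v" r] v n by (simp add: C_def)
  then have no: "{0, n - 1} \<notin> C" using ear_last[of n C] n by simp
  obtain e where e: "{e \<in> C. n \<in> e} = {e}" using tight_remove_last(2)[OF C n no] by blast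
  have "{n - 2, n} \<in> {e \<in> C. n \<in> e}" using 1 by simp
  then have "{e \<in> C. n \<in> e} = {{n - 2, n}}" unfolding e by simp
  then show thesis using that[OF C_def tight_remove_last(1)[OF C n no]] by blast
qed

text \<open>Rotation is compatible with deleting a vertex. A turn by \<open>p + 2\<close> of the
  larger polygon sends its last vertex \<open>n\<close> to \<open>Suc p\<close>, while the remaining
  vertices see a turn by \<open>Suc p\<close> of the smaller polygon.\<close>

lemma rot_Suc_skip:
  assumes "p < n" "y < n"
  shows "rot (Suc n) (p + 2) y = skip (Suc p) (rot n (Suc p) y)"
proof (cases "y + p + 1 < n")
  case True
  then show ?thesis by (simp add: rot_def skip_def)
next
  case False
  define z where "z = y + p + 1 - n"
  have z: "y + (p + 2) = z + Suc n" "y + Suc p = z + n" "z \<le> p" "z < n"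
    using False assms by (auto simp: z_def)
  have "rot (Suc n) (p + 2) y = z" "rot n (Suc p) y = z"
    unfolding rot_def z(1,2) mod_add_self2 using z(4) by simp_all
  then show ?thesis using z(3) by (simp add: skip_def)
qed

text \<open>The set left after the deletion is known only up to a rotation \<open>r\<close>. A
  further turn of the larger polygon makes it a relabelled copy of \<open>E\<close>, and the unknown
  \<open>r\<close> becomes the unknown place \<open>p\<close> behind which the deleted vertex
  returns. Its edge goes two steps back, which means to \<open>n\<close> if
  \<open>p = 0\<close>.\<close>

lemma insertion_form:
  assumes n: "n \<ge> 4" and B: "tight (Suc n) B"
    and C: "C = shift (Suc n) s B" "{e \<in> C. n \<notin> e} = shift n r E" "{e \<in> C. n \<in> e} = {{n - 2, n}}"
    and E: "E \<subseteq> edges n"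
  obtains p t where "p < n"
    "shift (Suc n) t B = insert {if p = 0 then n else p - 1, Suc p} (image (skip (Suc p)) ` E)"
proof -
  \<comment> \<open>\<open>p\<close> is the vertex that \<open>r\<close> carries to
    \<open>n - 1\<close>, just before the deleted vertex.\<close>
  define p where "p = rot n (n - r mod n) (n - 1)"
  have p: "p < n" using n by (simp add: p_def)
  have "rot n r p = n - 1"
    using rot_inverse[of "n - 1" n r] n by (simp add: p_def rot_commute[of n r])
  then have "(p + r) mod n = n - 1" by (simp add: rot_def)
  then have dvd: "n dvd r + Suc p"
  proof -
    have "(p + r) mod n + 1 = n" using \<open>(p + r) mod n = n - 1\<close> n by simp
    then have "(r + Suc p) mod n = 0" by (metis add.commute add_Suc_right mod_Suc_eq mod_self Suc_eq_plus1)
    then show ?thesis by blast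
  qed
  have rot_skip: "rot (Suc n) (p + 2) (rot n r x) = skip (Suc p) x" if "x < n" for x
    using that rot_Suc_skip[OF p rot_less[OF that, of r]] rot_id[OF that dvd] by (simp only: rot_rot)
  have img: "image (rot (Suc n) (p + 2)) ` shift n r E = image (skip (Suc p)) ` E"
    unfolding shift_eq_rot image_image
  proof (intro image_cong refl)
    fix e x assume "e \<in> E" "x \<in> e"
    then have "x < n" using E edges_subset by blast
    then show "rot (Suc n) (p + 2) (rot n r x) = skip (Suc p) x" by (rule rot_skip)
  qed
  have "C = {e \<in> C. n \<in> e} \<union> {e \<in> C. n \<notin> e}" by blast
  then have "C = insert {n - 2, n} (shift n r E)" by (simp only: C(2,3) insert_is_Un[symmetric])
  then have "shift (Suc n) (p + 2) C =
      insert (rot (Suc n) (p + 2) ` {n - 2, n}) (image (skip (Suc p)) ` E)"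
    using img by (simp add: shift_eq_rot)
  moreover have "rot (Suc n) (p + 2) n = Suc p"
  proof -
    have "n + (p + 2) = Suc p + Suc n" by simp
    then have "rot (Suc n) (p + 2) n = Suc p mod Suc n"
      unfolding rot_def by (metis mod_add_self2)
    then show ?thesis using p by simp
  qed
  moreover have "rot (Suc n) (p + 2) (n - 2) = (if p = 0 then n else p - 1)"
  proof (cases "p = 0")
    case False
    then have "n - 2 + (p + 2) = p - 1 + Suc n" using n by simp
    then have "rot (Suc n) (p + 2) (n - 2) = (p - 1) mod Suc n"
      unfolding rot_def by (metis mod_add_self2)
    then show ?thesis using p False by simp
  qed (use n in \<open>simp add: rot_def\<close>)
  ultimately show thesis using that[OF p, of "s + (p + 2)"] C(1) by (simp add: shift_shift)
qed

subsection \<open>Blocking sets from words\<close>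

text \<open>The \<open>k - 2\<close> short diagonals and the \<open>length W\<close> further edges
  add up to two less than the number \<open>k + length W\<close> of vertices, the size required of a
  blocker.\<close>

definition enc :: "nat \<Rightarrow> nat list \<Rightarrow> nat set set" where
  "enc k W = {{i, i + 2} | i. i + 2 < k} \<union> {{k + i, W ! i} | i. i < length W}"

text \<open>The first and last letter of \<open>W\<close> encode the diagonals that make \<open>k - 1\<close> and \<open>0\<close> ears.
  A precode may have further ears at \<open>k\<close> or at the last vertex; the two inequations of \<open>code\<close> exclude
  them, so that \<open>0, \<dots>, k - 1\<close> are all the ears.\<close>

definition precode :: "nat \<Rightarrow> nat list \<Rightarrow> bool" where
  "precode k W \<longleftrightarrow> 2 \<le> k \<and> 2 \<le> length W \<and> W ! 0 = k - 2 \<and> W ! (length W - 1) = 1 \<and>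
     (\<forall>i<length W. W ! i < k) \<and> (\<forall>i j. i < j \<longrightarrow> j < length W \<longrightarrow> W ! j \<le> Suc (W ! i))"

definition code :: "nat \<Rightarrow> nat list \<Rightarrow> bool" where
  "code k W \<longleftrightarrow> precode k W \<and> W ! 1 \<noteq> k - 1 \<and> W ! (length W - 2) \<noteq> 0"

lemma enc_core: "j = i + 2 \<Longrightarrow> j < k \<Longrightarrow> {i, j} \<in> enc k W"
  by (auto simp: enc_def)

lemma enc_leaf: "i < length W \<Longrightarrow> v = k + i \<Longrightarrow> x = W ! i \<Longrightarrow> {v, x} \<in> enc k W"
  by (auto simp: enc_def)

lemma encE:
  assumes "e \<in> enc k W"
  obtains i where "i + 2 < k" "e = {i, i + 2}" | i where "i < length W" "e = {k + i, W ! i}"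
  using assms by (auto simp: enc_def)

lemma mem_enc_iff:
  assumes "precode k W" "a < b"
  shows "{a, b} \<in> enc k W \<longleftrightarrow> b = a + 2 \<and> b < k \<or> (\<exists>i<length W. b = k + i \<and> a = W ! i)"
proof
  assume "{a, b} \<in> enc k W"
  then show "b = a + 2 \<and> b < k \<or> (\<exists>i<length W. b = k + i \<and> a = W ! i)"
  proof (cases rule: encE)
    case (1 i)
    then show ?thesis using assms(2) by (auto simp: doubleton_eq_iff)
  next
    case (2 i)
    then have "W ! i < k" using assms(1) by (simp add: precode_def)
    then show ?thesis using 2 assms(2) by (auto simp: doubleton_eq_iff)
  qed
next
  assume "b = a + 2 \<and> b < k \<or> (\<exists>i<length W. b = k + i \<and> a = W ! i)"
  then show "{a, b} \<in> enc k W"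
    using enc_core[of b a k W] enc_leaf[of _ W b k a] by (auto simp: insert_commute)
qed

lemma enc_edges:
  assumes "precode k W"
  shows "enc k W \<subseteq> edges (k + length W)"
proof
  fix e assume "e \<in> enc k W"
  then show "e \<in> edges (k + length W)"
  proof (cases rule: encE)
    case (2 i)
    then have "W ! i < k" using assms by (simp add: precode_def)
    then show ?thesis using 2 by simp
  qed simp
qed

text \<open>Counting in this direction suffices: the general lower bound for blocking sets supplies
  the reverse inequality.\<close>

lemma card_enc_le: "precode k W \<Longrightarrow> card (enc k W) \<le> k + length W - 2"
proof -
  assume k: "precode k W"
  have "enc k W = (\<lambda>i. {i, i + 2}) ` {..<k - 2} \<union> (\<lambda>i. {k + i, W ! i}) ` {..<length W}"
    by (auto simp: enc_def)
  then have "card (enc k W) \<le> card ((\<lambda>i. {i, i + 2}) ` {..<k - 2}) + card ((\<lambda>i. {k + i, W ! i}) ` {..<length W})"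
    by (simp only: card_Un_le)
  also have "\<dots> \<le> k - 2 + length W"
    using card_image_le[of "{..<k - 2}" "\<lambda>i. {i, i + 2}"]
      card_image_le[of "{..<length W}" "\<lambda>i. {k + i, W ! i}"] by simp
  finally show ?thesis using k by (simp add: precode_def)
qed

section \<open>Deleting a vertex behind the interval of ears\<close>

definition drop_nth :: "nat \<Rightarrow> 'a list \<Rightarrow> 'a list" where
  "drop_nth i xs = take i xs @ drop (Suc i) xs"

lemma length_drop_nth: "i < length xs \<Longrightarrow> length (drop_nth i xs) = length xs - 1"
  by (simp add: drop_nth_def)

lemma nth_drop_nth: "i < length xs \<Longrightarrow> j < length xs - 1 \<Longrightarrow> drop_nth i xs ! j = xs ! skip i j"
  by (auto simp: drop_nth_def nth_append skip_def min_def)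

text \<open>The vertex \<open>k + i\<close> disappears with its edge. The final letter
  \<open>1\<close> has to survive, and if the first letter goes, its successor must take over the
  value \<open>k - 2\<close>.\<close>

lemma precode_drop_nth:
  assumes W: "precode k W" and i: "Suc i < length W" "3 \<le> length W" "i = 0 \<Longrightarrow> W ! 1 = k - 2"
  shows "precode k (drop_nth i W)"
proof -
  have sk: "skip i j < length W" if "j < length W - 1" for j using that by (auto simp: skip_def)
  have "drop_nth i W ! 0 = k - 2"
  proof (cases "i = 0")
    case True
    have "0 < length W" "0 < length W - 1" using i by auto
    then show ?thesis using True i nth_drop_nth[of 0 W 0] by (simp add: skip_def)
  next
    case False
    then show ?thesis using i W by (simp add: nth_drop_nth skip_def precode_def)
  qed
  moreover have "drop_nth i W ! (length W - 1 - 1) = 1"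
  proof -
    have "skip i (length W - 1 - 1) = length W - 1" using i by (auto simp: skip_def)
    then show ?thesis using i W by (simp add: nth_drop_nth precode_def)
  qed
  moreover have "drop_nth i W ! j < k" if "j < length W - 1" for j
    using that W sk i by (simp add: nth_drop_nth precode_def)
  moreover have "drop_nth i W ! b \<le> Suc (drop_nth i W ! a)" if "a < b" "b < length W - 1" for a b
    using that W sk[of b] i by (simp add: nth_drop_nth precode_def)
  ultimately show ?thesis using W i by (simp add: precode_def length_drop_nth)
qed

text \<open>The vertex \<open>k\<close> is deleted and \<open>k - 1\<close> leaves the interval of
  ears: its diagonal \<open>{k - 3, k - 1}\<close> is now the edge encoded by the new first letter.
  No other edge may end at \<open>k - 1\<close>, whence the bound on the later letters.\<close>

lemma precode_Cons_tl:
  assumes W: "precode k W" and k: "3 \<le> k" and le: "\<And>i. 0 < i \<Longrightarrow> i < length W \<Longrightarrow> W ! i \<le> k - 2"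
  shows "precode (k - 1) ((k - 3) # tl W)"
proof -
  have len: "2 \<le> length W" using W by (simp add: precode_def)
  have nth: "((k - 3) # tl W) ! i = (if i = 0 then k - 3 else W ! i)" if "i < length W" for i
    using that len by (cases i) (auto simp: nth_tl)
  show ?thesis
    unfolding precode_def
  proof (intro conjI allI impI)
    show "2 \<le> k - 1" "2 \<le> length ((k - 3) # tl W)" "((k - 3) # tl W) ! 0 = k - 1 - 2"
      using k len by auto
    show "((k - 3) # tl W) ! (length ((k - 3) # tl W) - 1) = 1"
      using nth[of "length W - 1"] W len by (simp add: precode_def)
  next
    fix i assume "i < length ((k - 3) # tl W)"
    then have i: "i < length W" using len by simp
    show "((k - 3) # tl W) ! i < k - 1" unfolding nth[OF i] using le[of i] i k by auto
  next
    fix i j assume "i < j" "j < length ((k - 3) # tl W)"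
    then have ij: "i < j" "i < length W" "j < length W" using len by auto
    then show "((k - 3) # tl W) ! j \<le> Suc (((k - 3) # tl W) ! i)"
      unfolding nth[OF ij(2)] nth[OF ij(3)] using le[of j] k W by (auto simp: precode_def)
  qed
qed

lemma tri_meets_via_deletion:
  assumes T: "tri (Suc n) T" "{v, v + 2} \<in> T" "v + 2 \<le> n"
    and A: "\<And>T'. tri n T' \<Longrightarrow> A \<inter> T' \<noteq> {}"
    and sub: "\<And>e. e \<in> A \<Longrightarrow> skip (Suc v) ` e \<in> B"
  shows "B \<inter> T \<noteq> {}"
  using A[OF tri_delete_ear[OF T(1,3,2)]] sub by blast

text \<open>Every ear of a triangulation avoiding \<^term>\<open>enc k W\<close> sits at a vertex \<open>\<ge> k\<close>;
  deleting that vertex from the polygon again leaves a precode.\<close>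

lemma enc_meets_tri:
  assumes "precode k W" "k + length W = n" "tri n T"
  shows "enc k W \<inter> T \<noteq> {}"
  using assms
proof (induction n arbitrary: k W T)
  case 0
  then show ?case by (simp add: precode_def)
next
  case (Suc n)
  note W = Suc.prems(1) and n = Suc.prems(2) and T = Suc.prems(3)
  have k: "2 \<le> k" and len: "2 \<le> length W" and W0: "W ! 0 = k - 2"
    and last: "W ! (length W - 1) = 1"
    and less: "\<And>i. i < length W \<Longrightarrow> W ! i < k"
    and mono: "\<And>i j. i < j \<Longrightarrow> j < length W \<Longrightarrow> W ! j \<le> Suc (W ! i)"
    using W by (auto simp: precode_def)
  obtain v where v: "v + 2 < Suc n" "{v, v + 2} \<in> T"
    using tri_ear_exists[OF T] n k len by auto
  have v': "v + 2 \<le> n" using v by simp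
  \<comment> \<open>The ear of \<open>T\<close> is \<open>Suc v\<close>. Below \<open>k\<close>, its
    diagonal already belongs to \<open>enc k W\<close>, either as a short diagonal or through the
    first letter. Otherwise it is some \<open>k + i\<close>, but never the last vertex.\<close>
  consider "v + 2 < k" | "v + 2 = k" | "k \<le> Suc v" by linarith
  then show ?case
  proof cases
    case 1
    then show ?thesis using v enc_core[of "v + 2" v k W] by blast
  next
    case 2
    then have "{k, k - 2} \<in> enc k W" using len W0 by (intro enc_leaf[of 0]) auto
    then show ?thesis using v 2 by (metis IntI add_diff_cancel_right' empty_iff insert_commute)
  next
    case 3
    define i where "i = Suc v - k"
    have vi: "Suc v = k + i" and i: "Suc i < length W" using 3 v n by (auto simp: i_def)
    show ?thesis
    proof (cases "i > 0 \<or> W ! 1 = k - 2 \<and> 3 \<le> length W")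
      case True
      then have len3: "3 \<le> length W" using i by auto
      have pre: "precode k (drop_nth i W)"
        using True i len3 by (intro precode_drop_nth[OF W]) auto
      have len': "length (drop_nth i W) = length W - 1" using i by (simp add: length_drop_nth)
      show ?thesis
      proof (rule tri_meets_via_deletion[OF T v(2) v'])
        show "enc k (drop_nth i W) \<inter> T' \<noteq> {}" if "tri n T'" for T'
          using Suc.IH[OF pre _ that] len' n len by simp
        fix e assume "e \<in> enc k (drop_nth i W)"
        then show "skip (Suc v) ` e \<in> enc k W"
        proof (cases rule: encE)
          case (1 j)
          then have "skip (Suc v) ` e = {j, j + 2}" using vi by (simp add: skip_def)
          then show ?thesis using 1 by (simp add: enc_core)
        next
          case (2 j)
          have j: "j < length W - 1" "skip i j < length W" using 2 len' by (auto simp: skip_def)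
          then have "drop_nth i W ! j = W ! skip i j" using i by (simp add: nth_drop_nth)
          moreover have "W ! skip i j < k" using less j by simp
          ultimately have "skip (Suc v) ` e = {k + skip i j, W ! skip i j}"
            using 2 unfolding vi by (auto simp: skip_def)
          then show ?thesis using j by (simp add: enc_leaf)
        qed
      qed
    next
      case False
      then have vk: "Suc v = k" and f: "W ! 1 = k - 2 \<Longrightarrow> length W = 2" using vi len by auto
      show ?thesis
      \<comment> \<open>The ear of \<open>T\<close> is now \<open>k\<close>, with diagonal
        \<open>{k - 1, k + 1}\<close>; the letter \<open>W ! 1 = k - 1\<close> encodes just this
        diagonal.\<close>
      proof (cases "W ! 1 = k - 1")
        case True
        then have "{k + 1, k - 1} \<in> enc k W" using len by (intro enc_leaf[of 1]) auto
        moreover have "{k + 1, k - 1} = {v, v + 2}" using vk by auto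
        ultimately show ?thesis using v(2) by auto
      next
        case False
        have W1: "W ! 1 \<le> k - 2" using less[of 1] len False by simp
        have k3: "3 \<le> k"
        proof (rule ccontr)
          assume "\<not> 3 \<le> k"
          then have "k = 2" using k by simp
          then show False using W1 f last False by simp
        qed
        \<comment> \<open>If there is a third letter, then \<open>W ! 1\<close> is at most
          \<open>k - 3\<close>, and \<open>W ! j \<le> Suc (W ! 1)\<close> keeps all later letters
          off \<open>k - 1\<close>.\<close>
        have le: "W ! j \<le> k - 2" if "0 < j" "j < length W" for j
        proof (cases "j = 1")
          case False
          then have "length W \<noteq> 2" using that by simp
          then have "W ! 1 \<noteq> k - 2" using f by auto
          then have "Suc (W ! 1) \<le> k - 2" using W1 by simp
          then show ?thesis using mono[of 1 j] that False by simp
        qed (use W1 in simp)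
        have pre: "precode (k - 1) ((k - 3) # tl W)" using precode_Cons_tl[OF W k3 le] by simp
        have len': "length ((k - 3) # tl W) = length W" using len by simp
        show ?thesis
        proof (rule tri_meets_via_deletion[OF T v(2) v'])
          show "enc (k - 1) ((k - 3) # tl W) \<inter> T' \<noteq> {}" if "tri n T'" for T'
            using Suc.IH[OF pre _ that] len' n k by simp
          fix e assume "e \<in> enc (k - 1) ((k - 3) # tl W)"
          then show "skip (Suc v) ` e \<in> enc k W"
          proof (cases rule: encE)
            case (1 j)
            then have "skip (Suc v) ` e = {j, j + 2}" using vk by (simp add: skip_def)
            then show ?thesis using 1 by (simp add: enc_core)
          next
            case (2 j)
            show ?thesis
            proof (cases "j = 0")
              case True
              then have "skip (Suc v) ` e = {k - 3, k - 1}"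
                using 2 k3 vk by (simp add: skip_def insert_commute)
              then show ?thesis using k3 by (simp add: enc_core)
            next
              case False
              then have j: "j < length W" "((k - 3) # tl W) ! j = W ! j"
                using 2 len' by (auto simp: nth_Cons nth_tl split: nat.split)
              then have "skip (Suc v) ` e = {k + j, W ! j}"
                using 2 vk less[of j] False k by (simp add: skip_def)
              then show ?thesis using j by (simp add: enc_leaf)
            qed
          qed
        qed
      qed
    qed
  qed
qed

lemma enc_tight:
  assumes "precode k W" "n = k + length W"
  shows "tight n (enc k W)"
proof -
  have "4 \<le> n" using assms by (simp add: precode_def)
  moreover have "blocks n (enc k W)"
    using enc_edges[OF assms(1)] enc_meets_tri[OF assms(1)] assms(2) unfolding blocks_def by blast
  ultimately show ?thesis
    using blocks_card_ge[of n "enc k W"] card_enc_le[OF assms(1)] assms(2) by (simp add: tight_def)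
qed

subsection \<open>Enumeration of codes\<close>

text \<open>An insertion that gains an ear: a new vertex \<open>k + 1\<close> joined to
  \<open>k - 1\<close> makes \<open>k\<close> the last ear, and the old edge
  \<open>{k - 2, k}\<close> becomes a diagonal between ears.\<close>

lemma code_Suc:
  assumes "code k W"
  shows "code (Suc k) ((k - 1) # tl W)"
proof -
  have len: "2 \<le> length W" using assms by (simp add: code_def precode_def)
  have nth: "((k - 1) # tl W) ! i = (if i = 0 then k - 1 else W ! i)" if "i < length W" for i
    using that len by (cases i) (auto simp: nth_tl)
  have 1: "precode (Suc k) ((k - 1) # tl W)"
    unfolding precode_def
  proof (intro conjI allI impI)
    show "((k - 1) # tl W) ! (length ((k - 1) # tl W) - 1) = 1"
      using nth[of "length W - 1"] assms len by (simp add: code_def precode_def)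
  next
    fix i assume "i < length ((k - 1) # tl W)"
    then have i: "i < length W" using len by simp
    then have "W ! i < k" using assms by (simp add: code_def precode_def)
    then show "((k - 1) # tl W) ! i < Suc k" unfolding nth[OF i] by auto
  next
    fix i j assume "i < j" "j < length ((k - 1) # tl W)"
    then have ij: "i < j" "i < length W" "j < length W" using len by auto
    then have "W ! j \<le> Suc (W ! i)" "W ! j < k" using assms by (simp_all add: code_def precode_def)
    then show "((k - 1) # tl W) ! j \<le> Suc (((k - 1) # tl W) ! i)"
      unfolding nth[OF ij(2)] nth[OF ij(3)] using ij by simp
  qed (use assms len in \<open>auto simp: code_def precode_def\<close>)
  have "W ! 1 < k" using assms by (simp add: code_def precode_def)
  moreover have "W ! 1 \<noteq> k - 1" "W ! (length W - 2) \<noteq> 0" "2 \<le> k"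
    using assms by (simp_all add: code_def precode_def)
  moreover have "((k - 1) # tl W) ! 1 = W ! 1" using nth[of 1] len by simp
  moreover have "((k - 1) # tl W) ! (length W - 2) = (if length W = 2 then k - 1 else W ! (length W - 2))"
    using nth[of "length W - 2"] len by auto
  moreover have "length ((k - 1) # tl W) = length W" using len by simp
  ultimately show ?thesis using 1 unfolding code_def by (auto split: if_splits)
qed

lemma precode_Cons:
  assumes W: "precode k W"
  shows "precode k ((k - 2) # W)"
  unfolding precode_def
proof (intro conjI allI impI)
  fix i j assume "i < j" "j < length ((k - 2) # W)"
  then obtain j' where j: "j = Suc j'" "j' < length W" by (cases j) auto
  then have "W ! j' < k" using W by (simp add: precode_def)
  then show "((k - 2) # W) ! j \<le> Suc (((k - 2) # W) ! i)"
    using \<open>i < j\<close> j W by (cases i) (auto simp: precode_def)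
next
  fix i assume "i < length ((k - 2) # W)"
  then show "((k - 2) # W) ! i < k" using W by (cases i) (auto simp: precode_def)
qed (use W in \<open>auto simp: precode_def nth_Cons split: nat.split\<close>)

text \<open>An insertion that keeps the ears: a new vertex right behind the last ear is joined to
  \<open>k - 2\<close>, like the vertex formerly in that place.\<close>

lemma code_Cons:
  assumes "code k W"
  shows "code k ((k - 2) # W)"
proof -
  have "precode k W" "W ! (length W - 2) \<noteq> 0" "2 \<le> length W" "2 \<le> k" "W ! 0 = k - 2"
    using assms by (simp_all add: code_def precode_def)
  moreover from this have "((k - 2) # W) ! (length ((k - 2) # W) - 2) = W ! (length W - 2)"
    by (simp add: nth_Cons' Suc_diff_le numeral_2_eq_2)
  ultimately show ?thesis using precode_Cons[of k W] unfolding code_def by simp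
qed

text \<open>An insertion that loses an ear: the new vertex goes between \<open>k - 2\<close> and
  \<open>k - 1\<close>. The old last ear, now labelled \<open>k\<close>, may retain only its edge to
  \<open>k - 3\<close>, hence the condition on \<open>W\<close>.\<close>

lemma code_Cons_Cons:
  assumes c: "code k W" and no: "k - 1 \<notin> set W"
  shows "code (k - 1) ((k - 3) # (k - 3) # W)" "3 \<le> k"
proof -
  have W: "precode k W" using c by (simp add: code_def)
  have len: "2 \<le> length W" "2 \<le> k" "W ! (length W - 1) = 1" using W by (simp_all add: precode_def)
  then have "1 \<in> set W" by (metis diff_less less_le_trans nth_mem zero_less_numeral zero_less_one)
  with no len show k: "3 \<le> k" by (cases "k = 2") auto
  have le: "W ! i \<le> k - 2" if "i < length W" for i
  proof -
    have "W ! i < k" using W that by (simp add: precode_def)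
    moreover have "W ! i \<noteq> k - 1" using no that by (metis nth_mem)
    ultimately show ?thesis by simp
  qed
  have "precode (k - 1) ((k - 3) # tl ((k - 2) # W))"
    by (rule precode_Cons_tl[OF precode_Cons[OF W] k]) (use le in \<open>auto simp: nth_Cons split: nat.split\<close>)
  then have "precode (k - 1) ((k - 3) # W)" by simp
  from precode_Cons[OF this] have pre: "precode (k - 1) ((k - 3) # (k - 3) # W)"
    by (simp add: numeral_3_eq_3 numeral_2_eq_2)
  have "length W = Suc (Suc (length W - 2))" using len by simp
  then have "((k - 3) # (k - 3) # W) ! (length ((k - 3) # (k - 3) # W) - 2) = W ! (length W - 2)"
    by (metis add_2_eq_Suc' diff_Suc_Suc diff_zero length_Cons nth_Cons_Suc numeral_2_eq_2)
  then show "code (k - 1) ((k - 3) # (k - 3) # W)"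
    using pre c k unfolding code_def by simp
qed

text \<open>The start is the pentagon, whose blockers are all rotations of a single one; so
  \<open>codes m\<close> belongs to the polygon with \<open>m + 5\<close> vertices.\<close>

fun codes :: "nat \<Rightarrow> (nat \<times> nat list) set" where
  "codes 0 = {(3, [1, 1])}"
| "codes (Suc m) = (\<lambda>(k, W). (Suc k, (k - 1) # tl W)) ` codes m \<union>
     (\<lambda>(k, W). (k, (k - 2) # W)) ` codes m \<union>
     (\<lambda>(k, W). (k - 1, (k - 3) # (k - 3) # W)) ` {(k, W) \<in> codes m. k - 1 \<notin> set W}"

lemma codes_code: "(k, W) \<in> codes m \<Longrightarrow> code k W \<and> k + length W = m + 5"
proof (induction m arbitrary: k W)
  case 0
  then show ?case by (auto simp: code_def precode_def less_Suc_eq)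
next
  case (Suc m)
  from Suc.prems consider
    k' W' where "(k', W') \<in> codes m" "k = Suc k'" "W = (k' - 1) # tl W'" |
    W' where "(k, W') \<in> codes m" "W = (k - 2) # W'" |
    k' W' where "(k', W') \<in> codes m" "k' - 1 \<notin> set W'" "k = k' - 1" "W = (k' - 3) # (k' - 3) # W'"
    by auto
  then show ?case
  proof cases
    case (1 k' W')
    then have c: "code k' W'" "k' + length W' = m + 5" using Suc.IH by auto
    then have "W' \<noteq> []" by (auto simp: code_def precode_def)
    then show ?thesis using 1 c code_Suc[OF c(1)] by simp
  next
    case (2 W')
    then have c: "code k W'" "k + length W' = m + 5" using Suc.IH by auto
    then show ?thesis using 2 code_Cons[OF c(1)] by simp
  next
    case (3 k' W')
    then have c: "code k' W'" "k' + length W' = m + 5" using Suc.IH by auto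
    then show ?thesis using 3 code_Cons_Cons[OF c(1)] by simp
  qed
qed

lemma codesD:
  assumes "(k, W) \<in> codes m"
  shows "2 \<le> k" "2 \<le> length W" "W ! 0 = k - 2" "W ! 1 < k" "W ! 1 \<noteq> k - 1"
    "\<And>x. x \<in> set W \<Longrightarrow> x < k" "1 \<in> set W"
proof -
  have W: "precode k W" "W ! 1 \<noteq> k - 1" using codes_code[OF assms] by (simp_all add: code_def)
  then show "2 \<le> k" "2 \<le> length W" "W ! 0 = k - 2" "W ! 1 < k" "W ! 1 \<noteq> k - 1"
    "\<And>x. x \<in> set W \<Longrightarrow> x < k" by (auto simp: precode_def in_set_conv_nth)
  have "W ! (length W - 1) = 1" "length W - 1 < length W" using W by (auto simp: precode_def)
  then show "1 \<in> set W" by (metis nth_mem)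
qed

lemma finite_codes [simp]: "finite (codes m)"
proof (induction m)
  case (Suc m)
  then have "finite {(k, W) \<in> codes m. k - 1 \<notin> set W}" by (auto intro: rev_finite_subset)
  then show ?case using Suc by simp
qed simp

text \<open>The second and third letters reveal which insertion came last, so the three images are
  disjoint. The insertion \<open>a\<close> creates a last ear that no letter names, \<open>c\<close>
  one that is named by the third letter, and \<open>b\<close> does not affect whether the last ear
  is named.\<close>

lemma card_codes:
  "card (codes m) = fib (2 * m + 2) \<and> card {(k, W) \<in> codes m. k - 1 \<notin> set W} = fib (2 * m + 1)"
proof (induction m)
  case 0
  have "{(k, W). k = 3 \<and> W = [Suc 0, Suc 0] \<and> k - Suc 0 \<notin> set W} = {(3, [1, 1])}" by auto
  then show ?case by (simp add: numeral_2_eq_2)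
next
  case (Suc m)
  define S where "S = {(k, W) \<in> codes m. k - 1 \<notin> set W}"
  define a where "a = (\<lambda>(k, W). (Suc k, (k - 1) # tl W) :: nat \<times> nat list)"
  define b where "b = (\<lambda>(k, W). (k, (k - 2) # W) :: nat \<times> nat list)"
  define c where "c = (\<lambda>(k, W). (k - 1, (k - 3) # (k - 3) # W) :: nat \<times> nat list)"
  have codes: "codes (Suc m) = a ` codes m \<union> b ` codes m \<union> c ` S"
    by (simp add: a_def b_def c_def S_def)
  have S: "finite S" by (rule finite_subset[OF _ finite_codes[of m]]) (auto simp: S_def)
  have S3: "3 \<le> k" if "(k, W) \<in> S" for k W
    using that codes_code[of k W m] code_Cons_Cons(2)[of k W] by (auto simp: S_def)
  \<comment> \<open>\<open>tl\<close> forgets only the first letter, which is always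
    \<open>k - 2\<close>.\<close>
  have inj_a: "inj_on a (codes m)"
  proof (rule inj_onI, clarify)
    fix k W k' W' assume *: "(k, W) \<in> codes m" "(k', W') \<in> codes m" "a (k, W) = a (k', W')"
    then have "W = W ! 0 # tl W" "W' = W' ! 0 # tl W'"
      using codesD(2) by (metis Suc_1 Suc_le_length_iff list.sel(3) nth_Cons_0)+
    then show "k = k' \<and> W = W'"
      using * codesD(3)[OF *(1)] codesD(3)[OF *(2)] by (auto simp: a_def)
  qed
  have inj_b: "inj_on b (codes m)" by (auto simp: inj_on_def b_def)
  have inj_c: "inj_on c S"
  proof (rule inj_onI, clarify)
    fix k W k' W' assume "(k, W) \<in> S" "(k', W') \<in> S" "c (k, W) = c (k', W')"
    then show "k = k' \<and> W = W'" using S3[of k W] S3[of k' W'] by (auto simp: c_def)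
  qed
  \<comment> \<open>After \<open>a\<close> the second letter is at most \<open>k - 3\<close>; after
    \<open>b\<close> and \<open>c\<close> it is \<open>k - 2\<close>, and the third letter equals
    \<open>k - 1\<close> only after \<open>c\<close>.\<close>
  have A: "W ! 1 + 3 \<le> k" if mem: "(k, W) \<in> a ` codes m" for k W
  proof -
    obtain k' W' where *: "(k', W') \<in> codes m" "k = Suc k'" "W = (k' - 1) # tl W'"
      using mem by (auto simp: a_def)
    have "W ! 1 = W' ! 1" using codesD(2)[OF *(1)] *(3) by (simp add: nth_tl)
    then show ?thesis using codesD(1,4,5)[OF *(1)] *(2) by simp
  qed
  have B: "W ! 1 + 2 = k \<and> W ! 2 + 1 \<noteq> k" if mem: "(k, W) \<in> b ` codes m" for k W
  proof -
    obtain W' where *: "(k, W') \<in> codes m" "W = (k - 2) # W'" using mem by (auto simp: b_def)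
    then have "W ! 1 = k - 2" "W ! 2 = W' ! 1"
      using codesD(3)[OF *(1)] by (simp_all add: numeral_2_eq_2)
    then show ?thesis using codesD(1,5)[OF *(1)] by linarith
  qed
  have C: "W ! 1 + 2 = k \<and> W ! 2 + 1 = k" if mem: "(k, W) \<in> c ` S" for k W
  proof -
    obtain k' W' where *: "(k', W') \<in> S" "k = k' - 1" "W = (k' - 3) # (k' - 3) # W'"
      using mem by (auto simp: c_def)
    then have "(k', W') \<in> codes m" by (simp add: S_def)
    then have "W ! 1 = k' - 3" "W ! 2 = k' - 2"
      using codesD(3)[of k' W' m] *(3) by (simp_all add: numeral_2_eq_2)
    then show ?thesis using S3[OF *(1)] *(2) by linarith
  qed
  have "x \<notin> b ` codes m \<and> x \<notin> c ` S" if "x \<in> a ` codes m" for x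
    using that A[of "fst x" "snd x"] B[of "fst x" "snd x"] C[of "fst x" "snd x"] by auto
  moreover have "x \<notin> c ` S" if "x \<in> b ` codes m" for x
    using that B[of "fst x" "snd x"] C[of "fst x" "snd x"] by auto
  ultimately have disj: "a ` codes m \<inter> b ` codes m = {}" "(a ` codes m \<union> b ` codes m) \<inter> c ` S = {}"
    by blast+
  have card: "card (codes (Suc m)) = 2 * card (codes m) + card S"
    unfolding codes using disj S inj_a inj_b inj_c by (simp add: card_Un_disjoint card_image)
  define S' where "S' = {(k, W) \<in> codes (Suc m). k - 1 \<notin> set W}"
  have "S' = a ` codes m \<union> b ` S"
  proof (intro subset_antisym subsetI)
    fix x assume "x \<in> S'"
    then obtain k W where x: "x = (k, W)" "(k, W) \<in> codes (Suc m)" "k - 1 \<notin> set W"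
      by (auto simp: S'_def simp del: codes.simps)
    then consider "x \<in> a ` codes m" | "x \<in> b ` codes m" | "x \<in> c ` S" unfolding codes by blast
    then show "x \<in> a ` codes m \<union> b ` S"
    proof cases
      case 2
      then obtain W' where *: "(k, W') \<in> codes m" "W = (k - 2) # W'" using x by (auto simp: b_def)
      then have "(k, W') \<in> S" using x by (auto simp: S_def)
      then have "b (k, W') \<in> b ` S" by (rule imageI)
      then show ?thesis using x * by (simp add: b_def)
    next
      case 3
      then obtain k' W' where *: "(k', W') \<in> S" "k = k' - 1" "W = (k' - 3) # (k' - 3) # W'"
        using x by (auto simp: c_def)
      then have "(k', W') \<in> codes m" by (simp add: S_def)
      then have "W' ! 0 = k - 1" "0 < length W'" using codesD(2,3)[of k' W' m] *(2) by auto
      then have "k - 1 \<in> set W'" by (metis nth_mem)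
      then show ?thesis using x(3) *(3) by auto
    qed simp
  next
    fix x assume "x \<in> a ` codes m \<union> b ` S"
    then show "x \<in> S'"
    proof
      assume xa: "x \<in> a ` codes m"
      then obtain k W where *: "(k, W) \<in> codes m" "x = (Suc k, (k - 1) # tl W)"
        by (auto simp: a_def)
      have "k \<notin> set (tl W)" using codesD(6)[OF *(1), of k] by (cases W) auto
      then have "k \<notin> set ((k - 1) # tl W)" using codesD(1)[OF *(1)] by simp
      then show ?thesis using xa * unfolding S'_def codes by auto
    next
      assume "x \<in> b ` S"
      then obtain k W where *: "(k, W) \<in> S" "x = (k, (k - 2) # W)" by (auto simp: b_def)
      then have c: "(k, W) \<in> codes m" "k - 1 \<notin> set W" by (simp_all add: S_def)
      then have "b (k, W) \<in> b ` codes m" by blast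
      then show ?thesis using * c S3[OF *(1)] unfolding S'_def codes by (auto simp: b_def)
    qed
  qed
  moreover have "a ` codes m \<inter> b ` S = {}" using disj(1) by (auto simp: S_def)
  moreover have "inj_on b S" using inj_b by (rule inj_on_subset) (auto simp: S_def)
  ultimately have card': "card S' = card (codes m) + card S"
    using S inj_a by (simp add: card_Un_disjoint card_image)
  show ?case using card card' Suc.IH unfolding S_def[symmetric] S'_def[symmetric]
    by (simp add: numeral_2_eq_2 del: codes.simps)
qed

subsection \<open>Classification of blockers\<close>

text \<open>An ear \<open>v \<ge> k\<close> needs an edge from a neighbour of \<open>v\<close> into
  the interval, so \<open>v\<close> has to border on that interval: \<open>v = k\<close> requires
  \<open>W ! 1 = k - 1\<close>, and \<open>v = n - 1\<close> requires the last letter but one to be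
  \<open>0\<close>.\<close>

lemma ear_enc_iff:
  assumes c: "code k W" and n: "n = k + length W" and v: "v < n"
  shows "ear n (enc k W) v \<longleftrightarrow> v < k"
proof -
  have W: "precode k W" and strict: "W ! 1 \<noteq> k - 1" "W ! (length W - 2) \<noteq> 0"
    using c by (simp_all add: code_def)
  have k: "2 \<le> k" "2 \<le> length W" "W ! 0 = k - 2" "W ! (length W - 1) = 1"
    and less: "\<And>i. i < length W \<Longrightarrow> W ! i < k"
    using W by (simp_all add: precode_def)
  consider "v = 0" | "0 < v" "v < k" | "k \<le> v" "Suc v < n" | "v = n - 1" using v by linarith
  then show ?thesis
  proof cases
    case 1
    have "{n - 1, 1} \<in> enc k W" using k n by (intro enc_leaf[of "length W - 1"]) auto
    then show ?thesis using 1 k n ear_0[of n] by (simp add: insert_commute)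
  next
    case 2
    have "{v - 1, Suc v} \<in> enc k W"
    proof (cases "Suc v = k")
      case True
      then have "{Suc v, v - 1} \<in> enc k W" using k by (intro enc_leaf[of 0]) auto
      then show ?thesis by (simp add: insert_commute)
    qed (use 2 in \<open>auto intro: enc_core\<close>)
    then show ?thesis using 2 k n ear_mid[of v n] by simp
  next
    case 3
    have "{v - 1, Suc v} \<notin> enc k W"
    proof
      assume "{v - 1, Suc v} \<in> enc k W"
      moreover have "v - 1 < Suc v" by linarith
      ultimately obtain i where i: "i < length W" "Suc v = k + i" "v - 1 = W ! i"
        using mem_enc_iff[OF W, of "v - 1" "Suc v"] 3 by auto
      then have "i = 1" using less[of i] 3 k by linarith
      then show False using i strict by simp
    qed
    then show ?thesis using 3 k ear_mid[of v n] by simp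
  next
    case 4
    have "{0, n - 2} \<notin> enc k W"
    proof
      assume "{0, n - 2} \<in> enc k W"
      then obtain i where "n - 2 = k + i" "0 = W ! i"
        using mem_enc_iff[OF W, of 0 "n - 2"] k n by auto
      moreover from this have "i = length W - 2" using n k by simp
      ultimately show False using strict by simp
    qed
    moreover obtain m where "n = Suc m" using v by (cases n) auto
    moreover from this have "m \<ge> 1" using k n by linarith
    ultimately show ?thesis using 4 k n ear_last[of m] by (simp add: numeral_2_eq_2)
  qed
qed

text \<open>Vertex \<open>0\<close> is the only ear preceded by a non-ear, a property that rotations
  preserve; so the rotation fixes \<open>0\<close> and is trivial. Then \<open>k\<close> is read off
  from the ears, and each letter from the edge at a non-ear.\<close>

lemma enc_rotation_unique:
  assumes c: "code k W" "code k' W'" and n: "n = k + length W" "n = k' + length W'"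
    and eq: "shift n r (enc k W) = enc k' W'"
  shows "k = k' \<and> W = W'"
proof -
  have W: "precode k W" "precode k' W'" using c by (simp_all add: code_def)
  have k: "2 \<le> k" "2 \<le> length W" "2 \<le> k'" "2 \<le> length W'"
    using W by (simp_all add: precode_def)
  have E: "enc k W \<subseteq> edges n" using enc_edges[OF W(1)] n by simp
  have ears: "rot n r v < k' \<longleftrightarrow> v < k" if "v < n" for v
    using ear_shift[OF E that, of r] ear_enc_iff[OF c(1) n(1) that]
      ear_enc_iff[OF c(2) n(2) rot_less[OF that, of r]] eq n k by simp
  have "rot n r 0 = 0"
  proof (rule ccontr)
    assume nz: "rot n r 0 \<noteq> 0"
    have "rot n r (n - 1) = rot n (n - 1) (rot n r 0)"
      using n k rot_commute[of n r "n - 1" 0] rot_minus_1[of 0 n] by simp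
    also have "\<dots> = rot n r 0 - 1" using nz n k rot_minus_1[of "rot n r 0" n] by simp
    finally have "rot n r (n - 1) = rot n r 0 - 1" .
    moreover have "rot n r 0 < k'" using ears[of 0] n k by simp
    moreover have "\<not> rot n r (n - 1) < k'" using ears[of "n - 1"] n k by auto
    ultimately show False by simp
  qed
  then have "n dvd r" by (simp add: rot_def dvd_eq_mod_eq_0)
  then have eq': "enc k W = enc k' W'" using eq shift_id[OF E] by simp
  have "v < k \<longleftrightarrow> v < k'" if "v < n" for v
    using ear_enc_iff[OF c(1) n(1) that] ear_enc_iff[OF c(2) n(2) that] eq' by simp
  moreover have "k < n" "k' < n" using n k by auto
  ultimately have kk: "k = k'" by (metis linorder_neqE_nat order_less_irrefl)
  have "W ! i = W' ! i" if i: "i < length W" for i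
  proof -
    have "W ! i < k" using W i by (simp add: precode_def)
    moreover have "{W ! i, k + i} \<in> enc k' W'"
      using enc_leaf[OF i refl refl, of k] eq' by (simp add: insert_commute)
    ultimately show ?thesis using mem_enc_iff[OF W(2), of "W ! i" "k + i"] kk by auto
  qed
  then have "W = W'" using n kk by (intro nth_equalityI) auto
  with kk show ?thesis by simp
qed

section \<open>Admissible places for an inserted vertex\<close>

lemma mem_skip_image_iff: "{skip q a, skip q b} \<in> image (skip q) ` E \<longleftrightarrow> {a, b} \<in> E"
proof -
  have "inj (skip q)" by (rule injI) simp
  then have "inj (image (skip q))" by (simp add: inj_def inj_image_eq_iff)
  then have "skip q ` {a, b} \<in> image (skip q) ` E \<longleftrightarrow> {a, b} \<in> E" by (rule inj_image_mem_iff)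
  then show ?thesis by simp
qed

text \<open>Away from the end of the interval of ears, an insertion would join two non-ears or leave
  two edges at a non-ear, and tightness forbids both. The places \<open>p = k\<close>,
  \<open>p = k - 1\<close> and \<open>p = k - 2\<close> remain and give the three
  insertions.\<close>

lemma insertion_cases:
  assumes c: "code k W" and n: "n = k + length W" and p: "p < n"
    and D: "D = insert {if p = 0 then n else p - 1, Suc p} (image (skip (Suc p)) ` enc k W)"
    and tight: "tight (Suc n) D"
  shows "D = enc (Suc k) ((k - 1) # tl W) \<or> D = enc k ((k - 2) # W) \<or>
    k - 1 \<notin> set W \<and> D = enc (k - 1) ((k - 3) # (k - 3) # W)"
proof -
  have W: "precode k W" and strict: "W ! 1 \<noteq> k - 1" "W ! (length W - 2) \<noteq> 0"
    using c by (simp_all add: code_def)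
  have k: "2 \<le> k" "2 \<le> length W" "W ! 0 = k - 2" "W ! (length W - 1) = 1"
    and less: "\<And>i. i < length W \<Longrightarrow> W ! i < k"
    using W by (simp_all add: precode_def)
  have n4: "4 \<le> n" using k n by simp
  have old: "{a, b} \<in> D \<longleftrightarrow> {a', b'} \<in> enc k W"
    if "a = skip (Suc p) a'" "b = skip (Suc p) b'" for a b a' b'
  proof -
    have "Suc p \<notin> {a, b}" using that by simp
    then have "{a, b} \<noteq> {if p = 0 then n else p - 1, Suc p}" by auto
    then show ?thesis unfolding D that using mem_skip_image_iff by simp
  qed
  have new: "{if p = 0 then n else p - 1, Suc p} \<in> D" using D by simp
  \<comment> \<open>Inclusion suffices, because both sets are tight and hence have equally many
    edges.\<close>
  have eqI: "D = enc k' W'"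
    if W': "precode k' W'" "Suc n = k' + length W'"
      and sub: "{if p = 0 then n else p - 1, Suc p} \<in> enc k' W'"
        "\<And>i. i + 2 < k \<Longrightarrow> {skip (Suc p) i, skip (Suc p) (i + 2)} \<in> enc k' W'"
        "\<And>i. i < length W \<Longrightarrow> {skip (Suc p) (k + i), skip (Suc p) (W ! i)} \<in> enc k' W'" for k' W'
  proof (rule card_subset_eq)
    show "D \<subseteq> enc k' W'"
    proof
      fix e assume "e \<in> D"
      then consider "e = {if p = 0 then n else p - 1, Suc p}" |
        f where "f \<in> enc k W" "e = skip (Suc p) ` f" using D by auto
      then show "e \<in> enc k' W'"
      proof cases
        case 1
        then show ?thesis using sub(1) by simp
      next
        case (2 f)
        from 2(1) show ?thesis
        proof (cases rule: encE)
          case (1 i)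
          then show ?thesis using sub(2)[of i] 2(2) by simp
        next
          case (2 i)
          then show ?thesis using sub(3)[of i] \<open>e = _\<close> by simp
        qed
      qed
    qed
    show "finite (enc k' W')" using tight_finite[OF enc_tight[OF W']] .
    show "card D = card (enc k' W')" using tight enc_tight[OF W'] by (simp add: tight_def)
  qed
  consider (low) "p = 0" | (mid) "0 < p" "p + 3 \<le> k" | (C) "0 < p" "p + 2 = k" | (B) "p + 1 = k" |
    (A) "p = k" | (high) "k < p" by linarith
  then show ?thesis
  proof cases
    case low
    \<comment> \<open>The new vertex \<open>1\<close> and its partner \<open>n\<close> are both
      non-ears.\<close>
    have "\<not> ear (Suc n) D 1"
    proof -
      have "{0, 1} \<notin> enc k W" using mem_enc_iff[OF W, of 0 1] k by auto
      then have "{0, 2} \<notin> D" using old[of 0 0 2 1] low by (simp add: skip_def)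
      then show ?thesis using ear_mid[of 1 "Suc n"] n4 by (simp add: numeral_2_eq_2)
    qed
    moreover have "\<not> ear (Suc n) D n"
    proof -
      have "{0, n - 2} \<notin> enc k W"
      proof
        assume "{0, n - 2} \<in> enc k W"
        then obtain i where "n - 2 = k + i" "0 = W ! i"
          using mem_enc_iff[OF W, of 0 "n - 2"] k n by auto
        moreover from this have "i = length W - 2" using n k by simp
        ultimately show False using strict by simp
      qed
      moreover have "0 = skip (Suc p) 0" "n - 1 = skip (Suc p) (n - 2)"
        using low n4 by (auto simp: skip_def)
      ultimately have "{0, n - 1} \<notin> D" using old by blast
      then show ?thesis using ear_last[of n D] n4 by simp
    qed
    ultimately have "{n, 1} \<notin> D" using not_ear_no_edge[OF tight n4, of n 1] n4 by simp
    then show ?thesis using new low by simp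
  next
    case mid
    \<comment> \<open>The old ear \<open>p + 1\<close>, now \<open>p + 2\<close>, stops being an
      ear, since the new vertex \<open>p + 1\<close> has no edge except the one to
      \<open>p - 1\<close>. It still has two edges, inherited from its old ones.\<close>
    have "{p + 1, p + 3} \<notin> D"
    proof
      assume "{p + 1, p + 3} \<in> D"
      then consider "{p + 1, p + 3} = {p - 1, p + 1}" | e where "{p + 1, p + 3} = skip (Suc p) ` e"
        using D mid by auto
      then show False
      proof cases
        case 1
        then show False by (auto simp: doubleton_eq_iff)
      next
        case (2 e)
        then have "Suc p \<in> skip (Suc p) ` e" by (metis Suc_eq_plus1 insertI1)
        then show False by auto
      qed
    qed
    then have "\<not> ear (Suc n) D (p + 2)"
      using ear_mid[of "p + 2" "Suc n" D] mid n by (simp add: numeral_3_eq_3)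
    moreover have "{p - 1, p + 2} \<in> D"
      using old[of "p - 1" "p - 1" "p + 2" "p + 1"] mid enc_core[of "p + 1" "p - 1" k W]
      by (simp add: skip_def)
    moreover have "{p + 2, p + 4} \<in> D"
    proof -
      have "{p + 1, p + 3} \<in> enc k W"
      proof (cases "p + 3 = k")
        case True
        then have "{p + 3, p + 1} \<in> enc k W" using k by (intro enc_leaf[of 0]) auto
        then show ?thesis by (simp add: insert_commute)
      qed (use mid in \<open>auto intro: enc_core\<close>)
      then show ?thesis using old[of "p + 2" "p + 1" "p + 4" "p + 3"] by (simp add: skip_def)
    qed
    ultimately have "{p - 1, p + 2} = {p + 2, p + 4}"
      using not_ear_edge_unique[OF tight n4, of "p + 2" "{p - 1, p + 2}" "{p + 2, p + 4}"] mid n by simp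
    then show ?thesis by (auto simp: doubleton_eq_iff)
  next
    case C
    \<comment> \<open>The old last ear, now \<open>k\<close>, is no longer an ear; a letter
      \<open>k - 1\<close> would give it an edge besides \<open>{p - 1, k}\<close>.\<close>
    have no: "k - 1 \<notin> set W"
    proof
      assume "k - 1 \<in> set W"
      then obtain j where j: "j < length W" "W ! j = k - 1" by (auto simp: in_set_conv_nth)
      have "{k - 1, k + 1} \<notin> D"
      proof
        assume "{k - 1, k + 1} \<in> D"
        then consider "{k - 1, k + 1} = {p - 1, Suc p}" | e where "{k - 1, k + 1} = skip (Suc p) ` e"
          using D C by auto
        then show False
        proof cases
          case 1
          then show False using C by (auto simp: doubleton_eq_iff)
        next
          case (2 e)
          moreover have "Suc p = k - 1" using C by simp
          ultimately have "Suc p \<in> skip (Suc p) ` e" by (metis insertI1)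
          then show False by auto
        qed
      qed
      moreover have "0 < k" "Suc k < Suc n" using k n by auto
      ultimately have "\<not> ear (Suc n) D k" using ear_mid[of k "Suc n" D] by simp
      moreover have "{p - 1, k} \<in> D"
        using old[of "p - 1" "p - 1" k "p + 1"] C enc_core[of "p + 1" "p - 1" k W]
        by (simp add: skip_def)
      moreover have "{Suc (k + j), k} \<in> D"
        using old[of "Suc (k + j)" "k + j" k "k - 1"] C enc_leaf[of j W "k + j" k "k - 1"] j
        by (simp add: skip_def)
      ultimately have "{p - 1, k} = {Suc (k + j), k}"
        using not_ear_edge_unique[OF tight n4, of k "{p - 1, k}" "{Suc (k + j), k}"] k n by simp
      then show False using C by (auto simp: doubleton_eq_iff)
    qed
    have c': "code (k - 1) ((k - 3) # (k - 3) # W)" using code_Cons_Cons(1)[OF c no] .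
    have "D = enc (k - 1) ((k - 3) # (k - 3) # W)"
    proof (rule eqI)
      show "precode (k - 1) ((k - 3) # (k - 3) # W)" using c' by (simp add: code_def)
      show "Suc n = k - 1 + length ((k - 3) # (k - 3) # W)" using n k by simp
      have "{k - 1, k - 3} \<in> enc (k - 1) ((k - 3) # (k - 3) # W)" by (intro enc_leaf[of 0]) auto
      moreover have "{k - 1, k - 3} = {if p = 0 then n else p - 1, Suc p}" using C by auto
      ultimately show "{if p = 0 then n else p - 1, Suc p} \<in> enc (k - 1) ((k - 3) # (k - 3) # W)" by simp
    next
      fix i assume i: "i + 2 < k"
      show "{skip (Suc p) i, skip (Suc p) (i + 2)} \<in> enc (k - 1) ((k - 3) # (k - 3) # W)"
      proof (cases "i + 3 = k")
        case True
        then have "{k, k - 3} \<in> enc (k - 1) ((k - 3) # (k - 3) # W)" by (intro enc_leaf[of 1]) auto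
        moreover have "{k, k - 3} = {skip (Suc p) i, skip (Suc p) (i + 2)}"
          using True C by (auto simp: skip_def)
        ultimately show ?thesis by simp
      qed (use i C in \<open>auto simp: skip_def intro!: enc_core\<close>)
    next
      fix i assume i: "i < length W"
      have "W ! i < k - 1"
        using less[OF i] no i by (metis Suc_pred' k(1) less_SucE less_le_trans nth_mem zero_less_numeral)
      then have "skip (Suc p) (k + i) = k - 1 + Suc (Suc i)" "skip (Suc p) (W ! i) = W ! i"
        using C by (auto simp: skip_def)
      then show "{skip (Suc p) (k + i), skip (Suc p) (W ! i)} \<in> enc (k - 1) ((k - 3) # (k - 3) # W)"
        using i by (intro enc_leaf[of "Suc (Suc i)"]) auto
    qed
    then show ?thesis using no by blast
  next
    case B
    have "D = enc k ((k - 2) # W)"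
    proof (rule eqI)
      show "precode k ((k - 2) # W)" using precode_Cons[OF W] .
      have "{k, k - 2} \<in> enc k ((k - 2) # W)" by (intro enc_leaf[of 0]) auto
      moreover have "{k, k - 2} = {if p = 0 then n else p - 1, Suc p}" using B k by auto
      ultimately show "{if p = 0 then n else p - 1, Suc p} \<in> enc k ((k - 2) # W)" by simp
    next
      fix i assume "i + 2 < k"
      then show "{skip (Suc p) i, skip (Suc p) (i + 2)} \<in> enc k ((k - 2) # W)"
        using B by (auto simp: skip_def intro!: enc_core)
    next
      fix i assume i: "i < length W"
      have "skip (Suc p) (k + i) = k + Suc i" "skip (Suc p) (W ! i) = W ! i"
        using B less[OF i] by (auto simp: skip_def)
      then show "{skip (Suc p) (k + i), skip (Suc p) (W ! i)} \<in> enc k ((k - 2) # W)"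
        using i by (intro enc_leaf[of "Suc i"]) auto
    qed (use n in simp)
    then show ?thesis by blast
  next
    case A
    have c': "code (Suc k) ((k - 1) # tl W)" using code_Suc[OF c] .
    have "D = enc (Suc k) ((k - 1) # tl W)"
    proof (rule eqI)
      show "precode (Suc k) ((k - 1) # tl W)" using c' by (simp add: code_def)
      show "Suc n = Suc k + length ((k - 1) # tl W)" using n k by simp
      have "{Suc k, k - 1} \<in> enc (Suc k) ((k - 1) # tl W)" by (intro enc_leaf[of 0]) auto
      moreover have "{Suc k, k - 1} = {if p = 0 then n else p - 1, Suc p}" using A k by auto
      ultimately show "{if p = 0 then n else p - 1, Suc p} \<in> enc (Suc k) ((k - 1) # tl W)" by simp
    next
      fix i assume "i + 2 < k"
      then show "{skip (Suc p) i, skip (Suc p) (i + 2)} \<in> enc (Suc k) ((k - 1) # tl W)"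
        using A by (auto simp: skip_def intro!: enc_core)
    next
      fix i assume i: "i < length W"
      have W_i: "skip (Suc p) (W ! i) = W ! i" using A less[OF i] by (simp add: skip_def)
      show "{skip (Suc p) (k + i), skip (Suc p) (W ! i)} \<in> enc (Suc k) ((k - 1) # tl W)"
      proof (cases i)
        case 0
        then have "{skip (Suc p) (k + i), skip (Suc p) (W ! i)} = {k - 2, k}"
          using A k W_i by (auto simp: skip_def)
        then show ?thesis using enc_core[of k "k - 2" "Suc k"] k by simp
      next
        case (Suc j)
        then have "skip (Suc p) (k + i) = Suc k + i" using A by (simp add: skip_def)
        then show ?thesis using i W_i Suc by (intro enc_leaf[of i]) (auto simp: nth_tl)
      qed
    qed
    then show ?thesis by blast
  next
    case high
    \<comment> \<open>Again the new vertex \<open>Suc p\<close> and its partner \<open>p - 1\<close>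
      are both non-ears.\<close>
    have "\<not> ear (Suc n) D (Suc p)"
    proof (cases "Suc p = n")
      case True
      have "{0, n - 1} \<notin> enc k W"
      proof
        assume "{0, n - 1} \<in> enc k W"
        then obtain i where "n - 1 = k + i" "0 = W ! i"
          using mem_enc_iff[OF W, of 0 "n - 1"] k n by auto
        moreover from this have "i = length W - 1" using n k by simp
        ultimately show False using k by simp
      qed
      then have "{0, n - 1} \<notin> D" using old[of 0 0 "n - 1" "n - 1"] True n4 by (simp add: skip_def)
      then show ?thesis using True ear_last[of n D] n4 by simp
    next
      case False
      have "{p, Suc p} \<notin> enc k W"
      proof
        assume "{p, Suc p} \<in> enc k W"
        then obtain i where "i < length W" "p = W ! i"
          using mem_enc_iff[OF W, of p "Suc p"] by auto
        then show False using less high by force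
      qed
      then have "{p, Suc (Suc p)} \<notin> D" using old[of p p "Suc (Suc p)" "Suc p"] by (simp add: skip_def)
      then show ?thesis using ear_mid[of "Suc p" "Suc n" D] False p by simp
    qed
    moreover have "\<not> ear (Suc n) D (p - 1)"
    proof -
      have "{p - 2, p} \<notin> enc k W"
      proof
        assume "{p - 2, p} \<in> enc k W"
        then obtain i where i: "i < length W" "p = k + i" "p - 2 = W ! i"
          using mem_enc_iff[OF W, of "p - 2" p] high k by auto
        then have "i = 1" using less[of i] high k by linarith
        then show False using i strict by simp
      qed
      then have "{p - 2, p} \<notin> D" using old[of "p - 2" "p - 2" p p] by (simp add: skip_def)
      then show ?thesis using ear_mid[of "p - 1" "Suc n" D] high k p by (simp add: numeral_2_eq_2)
    qed
    ultimately have "{p - 1, Suc p} \<notin> D"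
      using not_ear_no_edge[OF tight n4, of "p - 1" "Suc p"] p by simp
    then show ?thesis using new high by simp
  qed
qed

lemma card_4_doubletons: "card {{0, 2}, {1, 3 :: nat}} = 2"
  by (simp add: doubleton_eq_iff)

text \<open>All four vertices are ears, so the quadrilateral has no \<open>code\<close>; the precode
  given by \<open>2\<close> and \<open>[0, 1]\<close> still shows that its two diagonals
  block.\<close>

lemma tight_4_iff: "tight 4 B \<longleftrightarrow> B = {{0, 2}, {1, 3}}"
proof
  assume B: "tight 4 B"
  have "{{0, 2}, {1, 3}} \<subseteq> B" using blocks_4[OF tight_blocks[OF B]] by simp
  then have "{{0, 2}, {1, 3}} = B"
    using B card_4_doubletons by (intro card_subset_eq[OF tight_finite[OF B]]) (simp_all add: tight_def)
  then show "B = {{0, 2}, {1, 3}}" by simp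
next
  have "precode 2 [0, 1]" by (auto simp: precode_def less_Suc_eq)
  then have "tight 4 (enc 2 [0, 1])" by (rule enc_tight) simp
  then have t: "tight 4 (enc 2 [0, 1])" .
  have "{{0, 2}, {1, 3}} \<subseteq> enc 2 [0, 1]" using blocks_4[OF tight_blocks[OF t]] by simp
  then have "{{0, 2}, {1, 3}} = enc 2 [0, 1]"
    using t card_4_doubletons by (intro card_subset_eq[OF tight_finite[OF t]]) (simp_all add: tight_def)
  then show "tight 4 B" if "B = {{0, 2}, {1, 3}}" using t that by simp
qed

lemma shift_inverse_ex: "B \<subseteq> edges n \<Longrightarrow> shift n r B = D \<Longrightarrow> \<exists>s. B = shift n s D"
  using shift_inverse by metis

lemma tight_code:
  assumes "tight (m + 5) B"
  shows "\<exists>r k W. (k, W) \<in> codes m \<and> B = shift (m + 5) r (enc k W)"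
  using assms
proof (induction m arbitrary: B)
  case 0
  then have B: "tight (Suc 4) B" by simp
  obtain r C where C: "C = shift (Suc 4) r B" "tight 4 {e \<in> C. 4 \<notin> e}" "{e \<in> C. 4 \<in> e} = {{4 - 2, 4}}"
    using tight_normalize[OF B order_refl] .
  have "C = {e \<in> C. 4 \<in> e} \<union> {e \<in> C. 4 \<notin> e}" by blast
  also have "\<dots> = {{2, 4}, {0, 2}, {1, 3}}" using C(2) unfolding C(3) tight_4_iff by (simp add: insert_commute)
  finally have C_eq: "C = {{2, 4}, {0, 2}, {1, 3}}" .
  have "enc 3 [1, 1] = {{0, 2}, {3, 1}, {4, 1}}"
  proof
    show "enc 3 [1, 1] \<subseteq> {{0, 2}, {3, 1}, {4, 1}}"
      by (rule subsetI, erule encE) (auto simp: less_Suc_eq)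
    show "{{0, 2}, {3, 1}, {4, 1}} \<subseteq> enc 3 [1, 1]"
      using enc_leaf[of 0 "[1, 1]" 3 3 1] enc_leaf[of 1 "[1, 1]" 4 3 1] enc_core[of 2 0 3 "[1, 1]"] by simp
  qed
  \<comment> \<open>A turn by \<open>4\<close> is one step backwards and takes the ears
    \<open>1\<close>, \<open>2\<close>, \<open>3\<close> of \<open>C\<close> to \<open>0\<close>,
    \<open>1\<close>, \<open>2\<close>.\<close>
  then have "shift 5 4 C = enc 3 [1, 1]"
    unfolding C_eq shift_def by (simp add: insert_commute)
  then have "shift 5 (r + 4) B = enc 3 [1, 1]" using C(1) by (simp add: shift_shift)
  from shift_inverse_ex[OF _ this] show ?case using tight_edges[OF B] by auto
next
  case (Suc m)
  define n where "n = m + 5"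
  have B: "tight (Suc n) B" and n: "n \<ge> 4" using Suc.prems by (simp_all add: n_def)
  obtain s C where C: "C = shift (Suc n) s B" "tight n {e \<in> C. n \<notin> e}" "{e \<in> C. n \<in> e} = {{n - 2, n}}"
    using tight_normalize[OF B n] .
  obtain r k W where c: "(k, W) \<in> codes m" "{e \<in> C. n \<notin> e} = shift n r (enc k W)"
    using Suc.IH[of "{e \<in> C. n \<notin> e}"] C(2) by (auto simp: n_def)
  have cd: "code k W" "n = k + length W" using codes_code[OF c(1)] by (simp_all add: n_def)
  then have E: "enc k W \<subseteq> edges n" using enc_edges[of k W] by (simp add: code_def)
  obtain p t where p: "p < n"
    and t: "shift (Suc n) t B = insert {if p = 0 then n else p - 1, Suc p} (image (skip (Suc p)) ` enc k W)"
    using insertion_form[OF n B C(1) c(2) C(3) E] by blast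
  define D where "D = shift (Suc n) t B"
  have "tight (Suc n) D" using B tight_shift by (simp add: D_def)
  from insertion_cases[OF cd p _ this] t
  have "D = enc (Suc k) ((k - 1) # tl W) \<or> D = enc k ((k - 2) # W) \<or>
      k - 1 \<notin> set W \<and> D = enc (k - 1) ((k - 3) # (k - 3) # W)" by (simp add: D_def)
  then obtain k' W' where c': "(k', W') \<in> codes (Suc m)" "D = enc k' W'"
  proof (elim disjE conjE)
    assume *: "D = enc (Suc k) ((k - 1) # tl W)"
    show thesis by (rule that[OF _ *]) (use c(1) in force)
  next
    assume *: "D = enc k ((k - 2) # W)"
    show thesis by (rule that[OF _ *]) (use c(1) in force)
  next
    assume *: "k - 1 \<notin> set W" "D = enc (k - 1) ((k - 3) # (k - 3) # W)"
    show thesis by (rule that[OF _ *(2)]) (use c(1) *(1) in force)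
  qed
  obtain u where "B = shift (Suc n) u D"
    using shift_inverse_ex[OF tight_edges[OF B], of t D] by (auto simp: D_def)
  then have "B = shift (Suc m + 5) u (enc k' W')" using c'(2) by (simp add: n_def)
  then show ?case using c'(1) by blast
qed

section \<open>Counting the rotation classes\<close>

lemma blockers_eq:
  assumes "n \<ge> 4" and P: "clockwise_ngon n P"
  shows "blockers n P = {B. tight n B}"
proof -
  \<comment> \<open>The lower bound has to be attained in order to be the minimum; this word attains
    it for every \<open>n \<ge> 4\<close>.\<close>
  have "precode (n - 2) [n - 4, 1]"
    using assms(1) by (auto simp: precode_def less_Suc_eq)
  then have t: "tight n (enc (n - 2) [n - 4, 1])" by (rule enc_tight) (use assms(1) in simp)
  show ?thesis
  proof (intro set_eqI iffI)
    fix B assume "B \<in> blockers n P"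
    then have B: "blocks n B" "card B \<le> card (enc (n - 2) [n - 4, 1])"
      using tight_blocks[OF t] by (auto simp: blockers_def blocker_def blocking_set_iff_blocks[OF P])
    then show "B \<in> {B. tight n B}"
      using blocks_card_ge[OF B(1) assms(1)] t by (simp add: tight_def)
  next
    fix B assume "B \<in> {B. tight n B}"
    then show "B \<in> blockers n P"
      using blocks_card_ge assms(1)
      by (auto simp: tight_def blockers_def blocker_def blocking_set_iff_blocks[OF P])
  qed
qed

theorem theorem1p2:
  fixes n :: nat and P :: "nat \<Rightarrow> real^2"
  assumes "n \<ge> 4"
    and "clockwise_ngon n P"
  shows "card (blockers n P // rotation_rel n P) = F (2 * n - 8)"
proof (cases "n = 4")
  case True
  \<comment> \<open>The two diagonals form the only blocker; its one class matches the convention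
    \<open>F 0 = 1\<close>.\<close>
  define B where "B = {{0, 2}, {1, 3 :: nat}}"
  have b: "blockers n P = {B}"
    using blockers_eq[OF assms] True by (simp add: tight_4_iff B_def)
  have "shift n 0 B = B" using True by (simp add: shift_id B_def)
  then have "rotation_rel n P = {(B, B)}" unfolding rotation_rel_def b by (auto intro: exI[of _ 0])
  then have "blockers n P // rotation_rel n P = {{B}}" unfolding b quotient_def by auto
  then show ?thesis using True by (simp add: F_def)
next
  case False
  define m where "m = n - 5"
  have n: "n = m + 5" using False assms(1) by (simp add: m_def)
  have R: "rotation_rel n P = {(A, B). tight n A \<and> tight n B \<and> (\<exists>r. B = shift n r A)}"
    unfolding rotation_rel_def blockers_eq[OF assms] by simp
  \<comment> \<open>Each class contains exactly one normal form, which makes \<open>cls\<close> a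
    bijection from \<open>codes m\<close> onto the classes.\<close>
  define cls where "cls = (\<lambda>(k, W). rotation_rel n P `` {enc k W})"
  have enc: "tight n (enc k W)" if "(k, W) \<in> codes m" for k W
    using codes_code[OF that] n by (intro enc_tight) (auto simp: code_def)
  have class_eq: "rotation_rel n P `` {shift n r A} = rotation_rel n P `` {A}" if "tight n A" for r A
  proof -
    have "(\<exists>s. X = shift n s (shift n r A)) \<longleftrightarrow> (\<exists>s. X = shift n s A)" for X
      using shift_inverse[OF tight_edges[OF that], of r] by (metis shift_shift)
    then show ?thesis unfolding R using that tight_shift by auto
  qed
  have "blockers n P // rotation_rel n P = cls ` codes m"
  proof (intro set_eqI iffI)
    fix X assume "X \<in> blockers n P // rotation_rel n P"
    then obtain B where B: "tight n B" "X = rotation_rel n P `` {B}"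
      unfolding blockers_eq[OF assms] by (auto elim: quotientE)
    then obtain r k W where c: "(k, W) \<in> codes m" "B = shift n r (enc k W)"
      using tight_code[of m B] n by auto
    then have "X = cls (k, W)" using B(2) class_eq[OF enc] by (simp add: cls_def)
    then show "X \<in> cls ` codes m" using c(1) by blast
  next
    fix X assume "X \<in> cls ` codes m"
    then obtain k W where "(k, W) \<in> codes m" "X = rotation_rel n P `` {enc k W}" by (auto simp: cls_def)
    then show "X \<in> blockers n P // rotation_rel n P"
      using enc by (auto simp: blockers_eq[OF assms] intro: quotientI)
  qed
  moreover have "inj_on cls (codes m)"
  proof (rule inj_onI, clarify)
    fix k W k' W' assume c: "(k, W) \<in> codes m" "(k', W') \<in> codes m" "cls (k, W) = cls (k', W')"
    have "enc k' W' = shift n 0 (enc k' W')" using tight_edges[OF enc[OF c(2)]] by (simp add: shift_id)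
    then have "enc k' W' \<in> cls (k', W')" using enc[OF c(2)] by (auto simp: cls_def R)
    then have "enc k' W' \<in> cls (k, W)" using c(3) by simp
    then obtain r where "shift n r (enc k W) = enc k' W'" by (auto simp: cls_def R)
    then show "k = k' \<and> W = W'"
      using enc_rotation_unique[of k W k' W' n r] codes_code[OF c(1)] codes_code[OF c(2)] n by simp
  qed
  ultimately have "card (blockers n P // rotation_rel n P) = fib (2 * m + 2)"
    using card_codes[of m] by (simp add: card_image)
  then show ?thesis using n by (simp add: F_def)
qed

end
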